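(* Let $k\geq 1$ be an integer, let $n\geq 2^{4k}$, and let $G$ be a graph of order $n$. (a) If $\mu(G)\geq \mu(S_{n,k})$, then $G$ contains a path $P_{2k+2}$ as a subgraph, unless $G=S_{n,k}$. (b) If $\mu(G)\geq \mu(S_{n,k}^{+})$, then $G$ contains a path $P_{2k+3}$ as a subgraph, unless $G=S_{n,k}^{+}$.
   Context: All graphs are finite and simple. For a graph $G$, $\mu(G)$ denotes the largest eigenvalue (spectral radius) of its adjacency matrix. $P_r$ denotes the path on $r$ vertices. For $1\leq k<n$, $S_{n,k}$ is the join of the complete graph $K_k$ and the edgeless graph $\overline{K}_{n-k}$ (every vertex of a $k$-clique is joined to every vertex of an independent set of $n-k$ vertices); $S_{n,k}^{+}$ is the graph obtained from $S_{n,k}$ by adding one edge inside the independent set of size $n-k$. Equality of graphs is up to isomorphism. One has $\mu(S_{n,k})=(k-1)/2+\sqrt{kn-(3k^2+2k-1)/4}$. *)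

theory Defs
  imports Complex_Main
begin

definition simple_graph :: "'a set \<Rightarrow> ('a \<Rightarrow> 'a \<Rightarrow> bool) \<Rightarrow> bool" where
  "simple_graph V E \<longleftrightarrow> finite V \<and> (\<forall>u v. E u v \<longrightarrow> u \<in> V \<and> v \<in> V)
      \<and> (\<forall>u v. E u v \<longrightarrow> E v u) \<and> (\<forall>v. \<not> E v v)"

definition adj_eigenvalue :: "'a set \<Rightarrow> ('a \<Rightarrow> 'a \<Rightarrow> bool) \<Rightarrow> real \<Rightarrow> bool" where
  "adj_eigenvalue V E lam \<longleftrightarrow>
     (\<exists>x :: 'a \<Rightarrow> real. (\<exists>v\<in>V. x v \<noteq> 0) \<and>
        (\<forall>v\<in>V. (\<Sum>u\<in>V. (if E v u then 1 else 0) * x u) = lam * x v))"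

definition spectral_radius :: "'a set \<Rightarrow> ('a \<Rightarrow> 'a \<Rightarrow> bool) \<Rightarrow> real" where
  "spectral_radius V E = Max {lam. adj_eigenvalue V E lam}"

definition has_path :: "'a set \<Rightarrow> ('a \<Rightarrow> 'a \<Rightarrow> bool) \<Rightarrow> nat \<Rightarrow> bool" where
  "has_path V E r \<longleftrightarrow> (\<exists>xs. length xs = r \<and> distinct xs \<and> set xs \<subseteq> V \<and>
       (\<forall>i. Suc i < r \<longrightarrow> E (xs ! i) (xs ! Suc i)))"

definition graph_iso :: "'a set \<Rightarrow> ('a \<Rightarrow> 'a \<Rightarrow> bool) \<Rightarrow> 'b set \<Rightarrow> ('b \<Rightarrow> 'b \<Rightarrow> bool) \<Rightarrow> bool" where
  "graph_iso V E W F \<longleftrightarrow> (\<exists>f. bij_betw f V W \<and> (\<forall>u\<in>V. \<forall>v\<in>V. E u v \<longleftrightarrow> F (f u) (f v)))"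

text \<open>S_{n,k} on vertex set {0..<n}: vertices 0..k-1 form the clique K_k,
  vertices k..n-1 the independent set.\<close>

definition S_graph :: "nat \<Rightarrow> nat \<Rightarrow> nat \<Rightarrow> nat \<Rightarrow> bool" where
  "S_graph n k i j \<longleftrightarrow> i < n \<and> j < n \<and> i \<noteq> j \<and> (i < k \<or> j < k)"

definition S_plus_graph :: "nat \<Rightarrow> nat \<Rightarrow> nat \<Rightarrow> nat \<Rightarrow> bool" where
  "S_plus_graph n k i j \<longleftrightarrow> S_graph n k i j \<or>
      (k + 1 < n \<and> ((i = k \<and> j = k + 1) \<or> (i = k + 1 \<and> j = k)))"

end

theory Submission
  imports Defs "HOL-Analysis.Function_Topology"
begin

text \<open>Let \<open>l\<close> be the spectral radius and \<open>x\<close> a positive eigenvector on a connected component \<open>Z\<close>.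
  If the graph has no path on \<open>2k + 3\<close> vertices and no \<open>K\<^bsub>k,k+3\<^esub>\<close>, then the number of pairs of
  adjacent vertices in \<open>H \<times> R\<close> is at most \<open>(3k + 2) |H| + (k - 1) |R|\<close>. With \<open>H\<close> the neighbours of a
  vertex and \<open>R\<close> all other vertices this gives \<open>l\<^sup>2 - (3k + 3) l \<le> (k - 1)(n - 1)\<close>, which
  contradicts \<open>l\<^sup>2 - (k - 1) l \<ge> k (n - k)\<close> for large \<open>n\<close> (\<open>k = 1\<close> is immediate). So \<open>Z\<close> contains
  \<open>K\<^bsub>k,k+3\<^esub>\<close>. Let \<open>S\<close> be its part of size \<open>k\<close>. Since the biclique contains long alternating paths, hardly
  any edge can lie outside \<open>S\<close>, and summing the eigenvalue equation over \<open>S\<close> bounds \<open>l\<close>, with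
  equality only for the extremal graphs.\<close>

section \<open>The spectral radius as a maximum of the Rayleigh quotient\<close>

text \<open>\<open>spectral_radius\<close> is a \<open>Max\<close>, so the set of eigenvalues has to
  be finite and nonempty before anything can be said: orthogonality of eigenvectors gives the first,
  a Rayleigh maximiser the second. The graph may be disconnected, so the estimates concern a
  component \<open>Z\<close> of unknown size. They are the polynomial inequalities that a root
  attains for the extremal graph, with \<open>card Z\<close> in place of \<open>n\<close>;
  comparison forces \<open>card Z = n\<close>, hence \<open>Z = V\<close>, and then equality
  throughout. For the extremal graphs it is enough to exhibit one eigenvalue each, since every
  eigenvalue is at most the radius. In (b) the question is whether exactly one edge lies outside
  \<open>S\<close>: if not, even the quadratic bound belonging to \<open>S_graph\<close> holds,
  which \<open>l\<close> strictly exceeds.\<close>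

lemma nonneg_unit_sphere_max:
  fixes a :: "'a \<Rightarrow> 'a \<Rightarrow> real"
  assumes "finite V" "V \<noteq> {}"
  obtains x where "\<And>v. 0 \<le> x v" "(\<Sum>v\<in>V. (x v)\<^sup>2) = 1"
    "\<And>y. (\<And>v. 0 \<le> y v) \<Longrightarrow> (\<Sum>v\<in>V. (y v)\<^sup>2) = 1 \<Longrightarrow>
       (\<Sum>u\<in>V. \<Sum>v\<in>V. a u v * y u * y v) \<le> (\<Sum>u\<in>V. \<Sum>v\<in>V. a u v * x u * x v)"
proof -
  define q where "q y = (\<Sum>u\<in>V. \<Sum>v\<in>V. a u v * y u * y v)" for y :: "'a \<Rightarrow> real"
  \<comment> \<open>The vertex type may be infinite. Pinning the coordinates outside
    \<open>V\<close> to 0 makes the box a product of compact sets over the whole type, so Tychonoff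
    applies.\<close>
  define I where "I v = (if v \<in> V then {0..1::real} else {0})" for v
  define K where "K = PiE UNIV I \<inter> {y. (\<Sum>v\<in>V. (y v)\<^sup>2) = 1}"
  have "compactin (product_topology (\<lambda>i::'a. euclidean) UNIV) (PiE UNIV I)"
    by (subst compactin_PiE) (auto simp: I_def)
  then have "compact (PiE UNIV I)"
    by (simp add: euclidean_product_topology)
  moreover have "closed {y :: 'a \<Rightarrow> real. (\<Sum>v\<in>V. (y v)\<^sup>2) = 1}"
    by (intro closed_Collect_eq continuous_intros continuous_on_product_coordinates)
  ultimately have K: "compact K"
    unfolding K_def by (rule compact_Int_closed)
  obtain v0 where v0: "v0 \<in> V" using assms by auto
  have "(\<lambda>v. if v = v0 then 1 else 0) \<in> K"
    using v0 assms by (simp add: K_def I_def PiE_iff if_distrib[of "\<lambda>t. t\<^sup>2"] cong: if_cong)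
  moreover have "continuous_on K q"
    unfolding q_def
    by (intro continuous_intros continuous_on_subset[OF continuous_on_product_coordinates] subset_UNIV)
  ultimately obtain x where x: "x \<in> K" "\<And>y. y \<in> K \<Longrightarrow> q y \<le> q x"
    using continuous_attains_sup[OF K] by blast
  show thesis
  proof
    have "x v \<in> I v" for v using x by (auto simp: K_def)
    then show "0 \<le> x v" for v by (force simp: I_def split: if_splits)
    show "(\<Sum>v\<in>V. (x v)\<^sup>2) = 1" using x by (simp add: K_def)
    fix y :: "'a \<Rightarrow> real" assume y: "\<And>v. 0 \<le> y v" "(\<Sum>v\<in>V. (y v)\<^sup>2) = 1"
    have le1: "y v \<le> 1" if "v \<in> V" for v
    proof -
      have "(y v)\<^sup>2 \<le> (\<Sum>v\<in>V. (y v)\<^sup>2)"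
        using that assms by (intro member_le_sum) auto
      with y show ?thesis by (simp add: abs_square_le_1[unfolded abs_le_iff])
    qed
    define y' where "y' v = (if v \<in> V then y v else 0)" for v
    have "(\<Sum>v\<in>V. (y' v)\<^sup>2) = (\<Sum>v\<in>V. (y v)\<^sup>2)" by (rule sum.cong) (auto simp: y'_def)
    then have "y' \<in> K" using y le1 by (auto simp: K_def I_def y'_def)
    moreover have "q y' = q y" unfolding q_def y'_def by (intro sum.cong) auto
    ultimately show "(\<Sum>u\<in>V. \<Sum>v\<in>V. a u v * y u * y v) \<le> (\<Sum>u\<in>V. \<Sum>v\<in>V. a u v * x u * x v)"
      using x(2)[of y'] by (simp add: q_def)
  qed
qed

text \<open>First-order optimality: a linear term dominated by a quadratic one vanishes. One test
  point \<open>b / s\<close> with \<open>s\<close> larger than \<open>c\<close> suffices.\<close>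

lemma linear_coeff_zero:
  fixes b c :: real
  assumes "\<And>t. b * t \<le> c * t\<^sup>2"
  shows "b = 0"
proof (rule ccontr)
  assume b: "b \<noteq> 0"
  define s where "s = \<bar>c\<bar> + 1"
  have s: "s > 0" by (simp add: s_def)
  have "b * (b / s) \<le> c * (b / s)\<^sup>2" by (rule assms)
  then have "b\<^sup>2 * s \<le> c * b\<^sup>2"
    using s by (simp add: field_simps power2_eq_square)
  then have "s \<le> c" using b by (simp add: mult.commute)
  then show False by (simp add: s_def)
qed

text \<open>The eigenvalue equation at \<open>w\<close> is stationarity of the Rayleigh quotient
  when coordinate \<open>w\<close> alone varies. Such a variation may leave the nonnegative vectors,
  so the maximum is first shown to dominate all real vectors, by passing to absolute values.\<close>

lemma perron_vector:
  fixes a :: "'a \<Rightarrow> 'a \<Rightarrow> real"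
  assumes V: "finite V" "V \<noteq> {}" and sym: "\<And>u v. a u v = a v u" and nonneg: "\<And>u v. 0 \<le> a u v"
  obtains x L where "\<And>v. 0 \<le> x v" "\<exists>v\<in>V. x v \<noteq> 0"
    "\<And>v. v \<in> V \<Longrightarrow> (\<Sum>u\<in>V. a v u * x u) = L * x v"
    "\<And>y. (\<Sum>u\<in>V. \<Sum>v\<in>V. a u v * y u * y v) \<le> L * (\<Sum>v\<in>V. (y v)\<^sup>2)"
proof -
  define q where "q y = (\<Sum>u\<in>V. \<Sum>v\<in>V. a u v * y u * y v)" for y :: "'a \<Rightarrow> real"
  define nn where "nn y = (\<Sum>v\<in>V. (y v)\<^sup>2)" for y :: "'a \<Rightarrow> real"
  obtain x where x: "\<And>v. 0 \<le> x v" "nn x = 1"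
    "\<And>y. (\<And>v. 0 \<le> y v) \<Longrightarrow> nn y = 1 \<Longrightarrow> q y \<le> q x"
    using nonneg_unit_sphere_max[OF V, of a, folded nn_def q_def] by blast
  define L where "L = q x"
  have bound: "q y \<le> L * nn y" for y
  proof (cases "nn y = 0")
    case True
    then have "\<forall>v\<in>V. y v = 0" using V by (simp add: nn_def sum_nonneg_eq_0_iff)
    then show ?thesis using True by (simp add: q_def)
  next
    case False
    then have pos: "nn y > 0" by (simp add: nn_def order_less_le sum_nonneg)
    define z where "z v = \<bar>y v\<bar> / sqrt (nn y)" for v
    have "nn z = 1"
      using pos by (simp add: nn_def z_def power_divide flip: sum_divide_distrib)
    then have "q z \<le> L" using x(3)[of z] pos by (simp add: z_def L_def)
    moreover have "q z = q (\<lambda>v. \<bar>y v\<bar>) / nn y"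
      using pos by (simp add: q_def z_def sum_divide_distrib)
    moreover have "q y \<le> q (\<lambda>v. \<bar>y v\<bar>)"
      unfolding q_def
    proof (intro sum_mono)
      fix u v
      have "y u * y v \<le> \<bar>y u\<bar> * \<bar>y v\<bar>" by (metis abs_ge_self abs_mult)
      then show "a u v * y u * y v \<le> a u v * \<bar>y u\<bar> * \<bar>y v\<bar>"
        using nonneg[of u v] by (simp add: mult.assoc mult_left_mono)
    qed
    ultimately show ?thesis using pos by (simp add: field_simps)
  qed
  have "(\<Sum>u\<in>V. a w u * x u) = L * x w" if w: "w \<in> V" for w
  proof -
    define S where "S = (\<Sum>u\<in>V. a w u * x u)"
    have q_shift: "q (\<lambda>v. x v + t * (if v = w then 1 else 0)) = q x + 2 * t * S + t\<^sup>2 * a w w" for t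
    proof -
      have "q (\<lambda>v. x v + t * (if v = w then 1 else 0))
        = (\<Sum>u\<in>V. \<Sum>v\<in>V. a u v * x u * x v)
          + (\<Sum>u\<in>V. \<Sum>v\<in>V. if v = w then t * (a u v * x u) else 0)
          + (\<Sum>u\<in>V. if u = w then (\<Sum>v\<in>V. t * (a u v * x v)) else 0)
          + (\<Sum>u\<in>V. if u = w then (\<Sum>v\<in>V. if v = w then t * (t * a u v) else 0) else 0)"
        unfolding q_def sum.distrib[symmetric]
        by (intro sum.cong refl) (auto simp: algebra_simps sum.distrib[symmetric] intro!: sum.cong)
      also have "\<dots> = q x + (\<Sum>u\<in>V. t * (a u w * x u)) + (\<Sum>v\<in>V. t * (a w v * x v)) + t * (t * a w w)"
        using V w by (simp add: q_def)
      also have "(\<Sum>u\<in>V. t * (a u w * x u)) = t * S"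
        by (simp add: S_def sum_distrib_left sym[of _ w])
      also have "(\<Sum>v\<in>V. t * (a w v * x v)) = t * S"
        by (simp add: S_def sum_distrib_left)
      finally show ?thesis by (simp add: power2_eq_square)
    qed
    have nn_shift: "nn (\<lambda>v. x v + t * (if v = w then 1 else 0)) = nn x + 2 * t * x w + t\<^sup>2" for t
    proof -
      have "nn (\<lambda>v. x v + t * (if v = w then 1 else 0))
        = (\<Sum>v\<in>V. (x v)\<^sup>2) + (\<Sum>v\<in>V. if v = w then 2 * t * x v + t\<^sup>2 else 0)"
        unfolding nn_def sum.distrib[symmetric]
        by (intro sum.cong refl) (auto simp: power2_eq_square algebra_simps)
      then show ?thesis using V w by (simp add: nn_def)
    qed
    have "(2 * (S - L * x w)) * t \<le> (L - a w w) * t\<^sup>2" for t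
      using bound[of "\<lambda>v. x v + t * (if v = w then 1 else 0)"] x(2)
      unfolding q_shift nn_shift L_def[symmetric] by (simp add: algebra_simps)
    then have "2 * (S - L * x w) = 0" by (rule linear_coeff_zero)
    then show ?thesis by (simp add: S_def)
  qed
  moreover have "\<exists>v\<in>V. x v \<noteq> 0"
  proof (rule ccontr)
    assume "\<not> ?thesis"
    then have "nn x = 0" by (simp add: nn_def)
    with x(2) show False by simp
  qed
  ultimately show thesis
    using that[of x L] x(1) bound by (auto simp: q_def nn_def)
qed

text \<open>Bessel's inequality for the indicator of \<open>w\<close> bounds
  \<open>\<Sum>i\<in>I. (y i w)\<^sup>2\<close> by 1; summing over \<open>w\<close> counts each unit
  vector once.\<close>

lemma orthonormal_card_le:
  fixes y :: "'i \<Rightarrow> 'a \<Rightarrow> real"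
  assumes V: "finite V" and I: "finite I"
    and orth: "\<And>i j. i \<in> I \<Longrightarrow> j \<in> I \<Longrightarrow> (\<Sum>v\<in>V. y i v * y j v) = (if i = j then 1 else 0)"
  shows "card I \<le> card V"
proof -
  have bessel: "(\<Sum>i\<in>I. (y i w)\<^sup>2) \<le> 1" if w: "w \<in> V" for w
  proof -
    \<comment> \<open>The orthogonal projection of the indicator of \<open>w\<close> onto the span
      of the family.\<close>
    define z where "z v = (\<Sum>i\<in>I. y i w * y i v)" for v
    have zz: "(\<Sum>v\<in>V. z v * z v) = (\<Sum>i\<in>I. (y i w)\<^sup>2)"
    proof -
      have "(\<Sum>v\<in>V. z v * z v) = (\<Sum>v\<in>V. \<Sum>i\<in>I. \<Sum>j\<in>I. y i w * y j w * (y i v * y j v))"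
        by (simp add: z_def sum_product algebra_simps)
      also have "\<dots> = (\<Sum>i\<in>I. \<Sum>v\<in>V. \<Sum>j\<in>I. y i w * y j w * (y i v * y j v))"
        by (rule sum.swap)
      also have "\<dots> = (\<Sum>i\<in>I. \<Sum>j\<in>I. \<Sum>v\<in>V. y i w * y j w * (y i v * y j v))"
        by (intro sum.cong refl sum.swap)
      also have "\<dots> = (\<Sum>i\<in>I. \<Sum>j\<in>I. y i w * y j w * (if i = j then 1 else 0))"
        by (intro sum.cong refl) (simp add: orth flip: sum_distrib_left)
      also have "\<dots> = (\<Sum>i\<in>I. (y i w)\<^sup>2)"
        using I by (simp add: if_distrib power2_eq_square cong: if_cong)
      finally show ?thesis .
    qed
    have "0 \<le> (\<Sum>v\<in>V. ((if v = w then 1 else 0) - z v)\<^sup>2)"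
      by (rule sum_nonneg) simp
    also have "\<dots> = (\<Sum>v\<in>V. if v = w then 1 - 2 * z v else 0) + (\<Sum>v\<in>V. z v * z v)"
      unfolding sum.distrib[symmetric]
      by (intro sum.cong refl) (auto simp: power2_eq_square algebra_simps)
    also have "\<dots> = 1 - 2 * z w + (\<Sum>v\<in>V. z v * z v)" using V w by simp
    also have "z w = (\<Sum>i\<in>I. (y i w)\<^sup>2)" by (simp add: z_def power2_eq_square)
    finally show ?thesis using zz by simp
  qed
  have "real (card I) = (\<Sum>i\<in>I. \<Sum>v\<in>V. (y i v)\<^sup>2)"
    using orth by (simp add: power2_eq_square)
  also have "\<dots> = (\<Sum>v\<in>V. \<Sum>i\<in>I. (y i v)\<^sup>2)" by (rule sum.swap)
  also have "\<dots> \<le> (\<Sum>v\<in>V. 1)" by (intro sum_mono bessel)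
  finally show ?thesis by simp
qed

text \<open>Eigenvectors of distinct eigenvalues are orthogonal by symmetry, so more than
  \<open>card V\<close> eigenvalues would give too large an orthonormal family.\<close>

lemma finite_adj_eigenvalues:
  assumes G: "simple_graph V E"
  shows "finite {l. adj_eigenvalue V E l}"
proof (rule ccontr)
  assume "\<not> ?thesis"
  then obtain I where I: "I \<subseteq> {l. adj_eigenvalue V E l}" "finite I" "card I = Suc (card V)"
    using infinite_arbitrarily_large by blast
  have V: "finite V" and E: "\<And>u v. E u v = E v u" using G by (auto simp: simple_graph_def)
  define a where "a u v = (if E u v then 1 else 0 :: real)" for u v
  have a: "a u v = a v u" for u v using E by (simp add: a_def)
  have "\<forall>l\<in>I. \<exists>y. (\<exists>v\<in>V. y v \<noteq> 0) \<and> (\<forall>v\<in>V. (\<Sum>u\<in>V. a v u * y u) = l * y v)"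
    using I(1) by (auto simp: adj_eigenvalue_def a_def)
  then obtain y where y: "\<And>l. l \<in> I \<Longrightarrow> \<exists>v\<in>V. y l v \<noteq> 0"
    "\<And>l v. l \<in> I \<Longrightarrow> v \<in> V \<Longrightarrow> (\<Sum>u\<in>V. a v u * y l u) = l * y l v" by metis
  define nn where "nn l = sqrt (\<Sum>v\<in>V. (y l v)\<^sup>2)" for l
  have nn: "nn l > 0" if "l \<in> I" for l
    using y(1)[OF that] V by (auto simp: nn_def intro!: sum_pos2)
  have "card I \<le> card V"
  proof (rule orthonormal_card_le[OF V I(2), of "\<lambda>l v. y l v / nn l"])
    fix l l' assume l: "l \<in> I" "l' \<in> I"
    have "l * (\<Sum>v\<in>V. y l v * y l' v) = l' * (\<Sum>v\<in>V. y l v * y l' v)"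
    proof -
      have "l * (\<Sum>v\<in>V. y l v * y l' v) = (\<Sum>v\<in>V. (\<Sum>u\<in>V. a v u * y l u) * y l' v)"
        using y(2) l by (simp add: sum_distrib_left mult.assoc)
      also have "\<dots> = (\<Sum>v\<in>V. \<Sum>u\<in>V. a v u * y l u * y l' v)" by (simp add: sum_distrib_right)
      also have "\<dots> = (\<Sum>u\<in>V. \<Sum>v\<in>V. a v u * y l u * y l' v)" by (rule sum.swap)
      also have "\<dots> = (\<Sum>u\<in>V. y l u * (\<Sum>v\<in>V. a u v * y l' v))"
        by (simp add: sum_distrib_left a mult.left_commute mult.commute)
      also have "\<dots> = l' * (\<Sum>v\<in>V. y l v * y l' v)"
        using y(2) l by (simp add: sum_distrib_left mult.left_commute)
      finally show ?thesis .
    qed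
    then have "(\<Sum>v\<in>V. y l v * y l' v) = 0" if "l \<noteq> l'" using that by simp
    moreover have "(\<Sum>v\<in>V. y l v * y l v) = nn l * nn l"
      by (simp add: nn_def sum_nonneg power2_eq_square)
    ultimately show "(\<Sum>v\<in>V. y l v / nn l * (y l' v / nn l')) = (if l = l' then 1 else 0)"
      using nn[OF l(1)] by (auto simp flip: sum_divide_distrib)
  qed
  then show False using I by simp
qed

lemma adj_eigenvalue_alt:
  assumes "finite V"
  shows "adj_eigenvalue V E l \<longleftrightarrow>
    (\<exists>x :: 'a \<Rightarrow> real. (\<exists>v\<in>V. x v \<noteq> 0) \<and> (\<forall>v\<in>V. (\<Sum>u | u \<in> V \<and> E v u. x u) = l * x v))"
proof -
  have "(\<Sum>u\<in>V. (if E v u then 1 else 0) * x u) = (\<Sum>u | u \<in> V \<and> E v u. x u)" for x :: "'a \<Rightarrow> real" and v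
    using assms by (intro sum.mono_neutral_cong_right) auto
  then show ?thesis by (simp add: adj_eigenvalue_def)
qed

lemma adj_eigenvalue_le_spectral_radius:
  assumes "simple_graph V E" "adj_eigenvalue V E l"
  shows "l \<le> spectral_radius V E"
  unfolding spectral_radius_def using finite_adj_eigenvalues assms by (intro Max_ge) auto

lemma spectral_radius_perron:
  assumes G: "simple_graph V E" and ne: "V \<noteq> {}"
  obtains x where "\<And>v. 0 \<le> x v" "\<exists>v\<in>V. x v \<noteq> 0"
    "\<And>v. v \<in> V \<Longrightarrow> (\<Sum>u | u \<in> V \<and> E v u. x u) = spectral_radius V E * x v"
proof -
  have V: "finite V" and E: "\<And>u v. E u v = E v u" using G by (auto simp: simple_graph_def)
  define a where "a u v = (if E u v then 1 else 0 :: real)" for u v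
  have a_sym: "a u v = a v u" and a_nonneg: "0 \<le> a u v" for u v using E by (auto simp: a_def)
  have a_sum: "(\<Sum>u\<in>V. a v u * y u) = (\<Sum>u | u \<in> V \<and> E v u. y u)" for y :: "'a \<Rightarrow> real" and v
    using V by (intro sum.mono_neutral_cong_right) (auto simp: a_def)
  obtain x L where x: "\<And>v. 0 \<le> x v" "\<exists>v\<in>V. x v \<noteq> 0"
    "\<And>v. v \<in> V \<Longrightarrow> (\<Sum>u\<in>V. a v u * x u) = L * x v"
    "\<And>y. (\<Sum>u\<in>V. \<Sum>v\<in>V. a u v * y u * y v) \<le> L * (\<Sum>v\<in>V. (y v)\<^sup>2)"
    by (rule perron_vector[OF V ne a_sym a_nonneg], rule that)
  have "spectral_radius V E = L"
    unfolding spectral_radius_def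
  proof (rule Max_eqI[OF finite_adj_eigenvalues[OF G]])
    show "L \<in> {l. adj_eigenvalue V E l}"
      using x(2,3) a_sum by (auto simp: adj_eigenvalue_alt[OF V])
    fix l assume "l \<in> {l. adj_eigenvalue V E l}"
    then obtain y where y: "\<exists>v\<in>V. y v \<noteq> 0" "\<And>v. v \<in> V \<Longrightarrow> (\<Sum>u\<in>V. a v u * y u) = l * y v"
      using a_sum by (auto simp: adj_eigenvalue_alt[OF V])
    have "(\<Sum>u\<in>V. \<Sum>v\<in>V. a u v * y u * y v) = (\<Sum>u\<in>V. y u * (\<Sum>v\<in>V. a u v * y v))"
      by (simp add: sum_distrib_left mult.left_commute mult.commute)
    also have "\<dots> = l * (\<Sum>v\<in>V. (y v)\<^sup>2)"
      by (simp add: y sum_distrib_left power2_eq_square mult.left_commute)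
    finally have "l * (\<Sum>v\<in>V. (y v)\<^sup>2) \<le> L * (\<Sum>v\<in>V. (y v)\<^sup>2)" using x(4)[of y] by simp
    moreover have "(\<Sum>v\<in>V. (y v)\<^sup>2) > 0" using y(1) V by (auto intro!: sum_pos2)
    ultimately show "l \<le> L" by simp
  qed
  then show thesis using that[of x] x a_sum by simp
qed

section \<open>Dense pairs in graphs without long paths\<close>

lemma has_path_iff:
  "has_path V E r \<longleftrightarrow>
    (\<exists>xs. length xs = r \<and> distinct xs \<and> set xs \<subseteq> V \<and> successively E xs)"
  unfolding has_path_def successively_conv_nth by (metis)

lemma has_path_shorter:
  assumes "has_path V E r" "r' \<le> r"
  shows "has_path V E r'"
proof -
  obtain xs where xs: "length xs = r" "distinct xs" "set xs \<subseteq> V" "successively E xs"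
    using assms(1) by (auto simp: has_path_iff)
  have "successively E (take r' xs)"
    using xs(1,4) assms(2) by (simp add: successively_conv_nth)
  moreover have "set (take r' xs) \<subseteq> V" using xs(3) set_take_subset by fast
  ultimately show ?thesis
    using xs assms(2) unfolding has_path_iff by (intro exI[of _ "take r' xs"]) simp
qed

definition has_biclique :: "'a set \<Rightarrow> ('a \<Rightarrow> 'a \<Rightarrow> bool) \<Rightarrow> nat \<Rightarrow> nat \<Rightarrow> bool" where
  "has_biclique V E s t \<longleftrightarrow> (\<exists>S T. S \<subseteq> V \<and> T \<subseteq> V \<and> S \<inter> T = {} \<and>
     card S = s \<and> t \<le> card T \<and> (\<forall>u\<in>S. \<forall>v\<in>T. E u v))"

text \<open>No two elements share a block \<open>{2 * m, 2 * m + 1}\<close>, and \<open>k\<close>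
  blocks cover the range. This will count the candidate neighbours of a path end.\<close>

lemma sparse_index_set_card:
  fixes J :: "nat set"
  assumes "\<And>i. i \<in> J \<Longrightarrow> i < 2 * k" "\<And>i. i \<in> J \<Longrightarrow> Suc i \<notin> J"
  shows "card J \<le> k"
proof -
  have "inj_on (\<lambda>i. i div 2) J"
  proof (rule inj_onI)
    fix i j assume "i \<in> J" "j \<in> J" "i div 2 = j div 2"
    moreover from this have "j = i \<or> j = Suc i \<or> i = Suc j" by presburger
    ultimately show "i = j" using assms(2) by auto
  qed
  moreover have "(\<lambda>i. i div 2) ` J \<subseteq> {..<k}" using assms(1) by force
  ultimately show ?thesis using card_inj_on_le[of _ J "{..<k}"] by simp
qed

text \<open>Take a longest path all of whose edges join \<open>H\<close> to \<open>R\<close>. Its ends lie outside \<open>H\<close>, and this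
  remains true after a rotation; hence the neighbours in \<open>H\<close> of an end are exactly the \<open>k\<close>
  path vertices in \<open>H\<close> whose predecessor is not in \<open>H\<close>. Any neighbour of the second vertex
  off the path can serve as the end, so all of them have the same \<open>k\<close> neighbours in \<open>H\<close>.\<close>

lemma dense_pair_has_biclique:
  fixes E :: "'a \<Rightarrow> 'a \<Rightarrow> bool"
  assumes Z: "finite Z" "H \<subseteq> Z" "R \<subseteq> Z" "H \<union> R \<noteq> {}"
    and sym: "\<And>u v. E u v \<Longrightarrow> E v u" and irr: "\<And>v. \<not> E v v" and k: "k \<ge> 1"
    and degH: "\<And>h. h \<in> H \<Longrightarrow> 3 * k + 3 \<le> card {r \<in> R. E h r}"
    and degR: "\<And>r. r \<in> R \<Longrightarrow> k \<le> card {h \<in> H. E r h}"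
    and no_path: "\<not> has_path Z E (2 * k + 3)"
  shows "has_biclique Z E k (k + 3)"
proof -
  \<comment> \<open>\<open>H\<close> and \<open>R\<close> may overlap, so these paths need not
    alternate between disjoint classes; what matters below is whether a vertex is in
    \<open>H\<close>.\<close>
  define F where "F a b \<longleftrightarrow> E a b \<and> (a \<in> H \<and> b \<in> R \<or> a \<in> R \<and> b \<in> H)" for a b
  have F_sym: "F a b \<Longrightarrow> F b a" for a b using sym by (auto simp: F_def)
  define pth where "pth xs \<longleftrightarrow> distinct xs \<and> set xs \<subseteq> H \<union> R \<and> successively F xs \<and> xs \<noteq> []" for xs
  have fin: "finite H" "finite R" using Z finite_subset by auto
  have len: "length xs \<le> 2 * k + 2" if "pth xs" for xs
  proof (rule ccontr)
    assume "\<not> ?thesis"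
    moreover have "successively E xs"
      using that by (auto simp: pth_def F_def elim: successively_mono)
    then have "has_path Z E (length xs)"
      using that subset_trans[OF _ Un_least[OF Z(2,3)]]
      unfolding pth_def has_path_iff by (intro exI[of _ xs]) simp
    ultimately show False using no_path has_path_shorter[of Z E "length xs" "2 * k + 3"] by simp
  qed
  obtain v0 where "v0 \<in> H \<union> R" using Z(4) by blast
  then have "pth [v0]" by (simp add: pth_def)
  then obtain xs where xs: "pth xs" "\<And>ys. pth ys \<Longrightarrow> length ys \<le> length xs"
    using ex_has_greatest_nat[of pth "[v0]" length "2 * k + 3"] len by (fastforce simp: less_Suc_eq_le)
  define p where "p = length xs"
  have ext: "a \<in> set ys" if "pth ys" "length ys = p" "F a (hd ys)" for a ys
  proof (rule ccontr)
    assume "a \<notin> set ys"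
    then have "pth (a # ys)" using that by (auto simp: pth_def successively_Cons F_def)
    from xs(2)[OF this] that show False by (simp add: p_def)
  qed
  \<comment> \<open>An end in \<open>H\<close> would have all its \<open>R\<close>-neighbours on the
    path: at least \<open>3 * k + 3\<close> of them among at most \<open>2 * k + 2\<close>
    vertices.\<close>
  have hd_notin: "hd ys \<notin> H" if ys: "pth ys" "length ys = p" for ys
  proof
    assume h: "hd ys \<in> H"
    have "{r \<in> R. E (hd ys) r} \<subseteq> set ys"
      using h ext[OF ys] sym by (auto simp: F_def)
    then have "card {r \<in> R. E (hd ys) r} \<le> card (set ys)" by (intro card_mono) auto
    also have "\<dots> \<le> 2 * k + 2" using len[OF ys(1)] card_length[of ys] by linarith
    finally show False using degH[OF h] by simp
  qed
  have last_notin: "last ys \<notin> H" if "pth ys" "length ys = p" for ys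
  proof -
    have "pth (rev ys)"
      using that F_sym by (auto simp: pth_def elim: successively_mono)
    from hd_notin[OF this] that show ?thesis by (simp add: hd_rev)
  qed
  obtain q1 rest where q1: "xs = q1 # rest" using xs(1) by (cases xs) (auto simp: pth_def)
  have "q1 \<notin> H" using hd_notin[OF xs(1)] by (simp add: p_def q1)
  moreover have "q1 \<in> H \<union> R" using xs(1) by (simp add: pth_def q1)
  ultimately have "q1 \<in> R" by simp
  then have "{h \<in> H. E q1 h} \<noteq> {}" using degR[of q1] k by fastforce
  then obtain h where "h \<in> H" "E q1 h" by blast
  then have "h \<in> set xs" using ext[OF xs(1)] sym \<open>q1 \<in> R\<close> by (auto simp: q1 p_def F_def)
  then have rest: "rest \<noteq> []" using \<open>h \<in> H\<close> \<open>q1 \<notin> H\<close> q1 by auto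
  define q2 where "q2 = hd rest"
  have "F q1 q2" using xs(1) rest by (simp add: pth_def q1 successively_Cons q2_def)
  then have q2: "q2 \<in> H" using \<open>q1 \<notin> H\<close> by (auto simp: F_def)
  have rest_path: "distinct rest" "set rest \<subseteq> H \<union> R" "successively F rest"
    using xs(1) rest by (auto simp: pth_def q1 successively_Cons)
  have len_rest: "length rest \<le> 2 * k + 1" using len[OF xs(1)] q1 by simp
  \<comment> \<open>Index 0 is \<open>q2\<close>, preceded by the exchangeable first vertex. The
    last vertex is an end, hence not in \<open>H\<close>; leaving it out keeps the indices below
    \<open>2 * k\<close>.\<close>
  define J where "J = {i. Suc i < length rest \<and> rest ! i \<in> H \<and> (i = 0 \<or> rest ! (i - 1) \<notin> H)}"
  define S where "S = (!) rest ` J"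
  have "card J \<le> k"
  proof (rule sparse_index_set_card)
    show "i < 2 * k" if "i \<in> J" for i using that len_rest by (simp add: J_def)
    show "Suc i \<notin> J" if "i \<in> J" for i using that by (simp add: J_def)
  qed
  moreover have "finite J" by (rule finite_subset[of _ "{..<length rest}"]) (auto simp: J_def)
  ultimately have S: "finite S" "card S \<le> k"
    using card_image_le[of J "(!) rest"] by (auto simp: S_def)
  define T where "T = {z \<in> R. E q2 z \<and> z \<notin> set rest}"
  have T: "z \<notin> H \<and> {h \<in> H. E z h} = S" if z: "z \<in> T" for z
  proof -
    have zF: "z \<in> R" "F z q2" "z \<notin> set rest" using z q2 sym by (auto simp: T_def F_def)
    have zp: "pth (z # rest)"
      using zF rest_path rest by (auto simp: pth_def successively_Cons q2_def)
    have zl: "length (z # rest) = p" by (simp add: p_def q1)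
    have zH: "z \<notin> H" using hd_notin[OF zp zl] by simp
    have sub: "{h \<in> H. E z h} \<subseteq> S"
    proof
      fix h assume "h \<in> {h \<in> H. E z h}"
      then have h: "h \<in> H" "E z h" by auto
      then have "h \<in> set (z # rest)" using ext[OF zp zl] zF sym by (auto simp: F_def)
      then obtain i where i: "i < length rest" "rest ! i = h"
        using h zH by (auto simp: in_set_conv_nth)
      have "last rest \<notin> H" using last_notin[OF zp zl] rest by simp
      moreover have "last rest = h" if "Suc i = length rest"
        using i rest by (simp add: last_conv_nth flip: that)
      ultimately have "Suc i \<noteq> length rest" using h by blast
      then have "Suc i < length rest" using i by simp
      moreover have "rest ! (i - 1) \<notin> H" if "i \<noteq> 0"
      proof -
        \<comment> \<open>Rotation: the edge from \<open>z\<close> to \<open>rest ! i\<close>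
          replaces the one from \<open>rest ! (i - 1)\<close> to \<open>rest ! i\<close>, which
          makes \<open>rest ! (i - 1)\<close> an end of an equally long path.\<close>
        define ys where "ys = rev (z # take i rest) @ drop i rest"
        have split: "successively F (take i rest)" "successively F (drop i rest)"
          using rest_path(3) successively_append_iff[of F "take i rest" "drop i rest"] by auto
        have "hd (take i rest) = q2" using that rest by (simp add: q2_def)
        then have "successively F (z # take i rest)"
          using split(1) zF by (auto simp: successively_Cons)
        then have "successively F (rev (z # take i rest))"
          unfolding successively_rev using F_sym by (auto elim: successively_mono)
        moreover have "hd (drop i rest) = h" using i by (simp add: hd_drop_conv_nth)
        moreover have "F z h" using h zF by (simp add: F_def)
        ultimately have "successively F ys"
          unfolding ys_def successively_append_iff using split(2) by simp
        moreover obtain A B where AB: "rest = A @ B" "ys = rev (z # A) @ B"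
          unfolding ys_def by (metis append_take_drop_id)
        then have "distinct ys" "set ys = insert z (set rest)"
          using rest_path(1) zF(3) by auto
        ultimately have "pth ys" using rest_path zF by (auto simp: pth_def)
        moreover have "length ys = p" using i by (simp add: ys_def p_def q1)
        ultimately have "hd ys \<notin> H" by (rule hd_notin)
        moreover have "hd ys = rest ! (i - 1)"
          using that i rest by (simp add: ys_def hd_rev hd_append last_conv_nth)
        ultimately show ?thesis by simp
      qed
      ultimately have "i \<in> J" using h i by (auto simp: J_def)
      then show "h \<in> S" using i by (auto simp: S_def)
    qed
    have "k \<le> card {h \<in> H. E z h}" using degR zF(1) .
    then have "card S \<le> card {h \<in> H. E z h}" using S(2) by simp
    then have "{h \<in> H. E z h} = S" using sub S(1) by (intro card_seteq)
    then show ?thesis using zH by simp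
  qed
  \<comment> \<open>At most \<open>2 * k\<close> vertices of \<open>rest\<close> other than
    \<open>q2\<close> are neighbours of \<open>q2\<close>, so \<open>3 * k + 3\<close> is just what
    leaves \<open>k + 3\<close> for \<open>T\<close>.\<close>
  have "3 * k + 3 \<le> card {r \<in> R. E q2 r}" by (rule degH[OF q2])
  also have "\<dots> \<le> card (T \<union> set (tl rest))"
  proof (rule card_mono)
    show "finite (T \<union> set (tl rest))" using fin by (simp add: T_def)
    have "set rest = insert q2 (set (tl rest))" using rest by (cases rest) (auto simp: q2_def)
    then show "{r \<in> R. E q2 r} \<subseteq> T \<union> set (tl rest)" using irr by (auto simp: T_def)
  qed
  also have "\<dots> \<le> card T + card (set (tl rest))" by (rule card_Un_le)
  also have "card (set (tl rest)) \<le> 2 * k" using card_length[of "tl rest"] len_rest by simp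
  finally have cardT: "k + 3 \<le> card T" by simp
  then obtain z where z: "z \<in> T" by fastforce
  have "k \<le> card {h \<in> H. E z h}" using degR z by (simp add: T_def)
  then have "card S = k" using T[OF z] S by simp
  moreover have "S \<subseteq> H" by (auto simp: S_def J_def)
  moreover have "T \<subseteq> R" "S \<inter> T = {}" using T \<open>S \<subseteq> H\<close> by (auto simp: T_def)
  moreover have "E u v" if "u \<in> S" "v \<in> T" for u v using T[OF that(2)] that(1) sym by auto
  ultimately show ?thesis
    unfolding has_biclique_def using cardT Z by (intro exI[of _ S] exI[of _ T]) auto
qed

text \<open>Vertices are peeled off one at a time: by the dense-pair lemma a nonempty pair has an
  \<open>h\<close> contributing at most \<open>3 * k + 2\<close> or an \<open>r\<close> contributing
  at most \<open>k - 1\<close>. A vertex in both sets leaves them separately, so overlap does no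
  harm.\<close>

lemma biclique_free_edge_bound:
  fixes E :: "'a \<Rightarrow> 'a \<Rightarrow> bool"
  assumes Z: "finite Z" and sym: "\<And>u v. E u v \<Longrightarrow> E v u" and irr: "\<And>v. \<not> E v v" and k: "k \<ge> 1"
    and no_path: "\<not> has_path Z E (2 * k + 3)" and no_bic: "\<not> has_biclique Z E k (k + 3)"
  shows "H \<subseteq> Z \<Longrightarrow> R \<subseteq> Z \<Longrightarrow>
    (\<Sum>h\<in>H. card {r \<in> R. E h r}) \<le> (3 * k + 2) * card H + (k - 1) * card R"
proof (induction "card H + card R" arbitrary: H R rule: less_induct)
  case less
  have fin: "finite H" "finite R" using less.prems Z finite_subset by auto
  consider "H \<union> R = {}"
    | h where "h \<in> H" "card {r \<in> R. E h r} \<le> 3 * k + 2"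
    | r where "r \<in> R" "card {h \<in> H. E r h} \<le> k - 1"
  proof (rule ccontr)
    assume "\<not> thesis"
    then have "H \<union> R \<noteq> {}" "\<And>h. h \<in> H \<Longrightarrow> 3 * k + 3 \<le> card {r \<in> R. E h r}"
      "\<And>r. r \<in> R \<Longrightarrow> k \<le> card {h \<in> H. E r h}"
      using that by (blast, force, force)
    from dense_pair_has_biclique[OF Z less.prems this(1) sym irr k this(2,3) no_path] no_bic
    show False by simp
  qed
  then show ?case
  proof cases
    case 1
    then show ?thesis by simp
  next
    case 2
    then obtain m where c: "card (H - {h}) = m" "card H = Suc m"
      using card_Suc_Diff1[OF fin(1), of h] by metis
    have "(\<Sum>h\<in>H - {h}. card {r \<in> R. E h r}) \<le> (3 * k + 2) * card (H - {h}) + (k - 1) * card R"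
      by (rule less.hyps) (use c less.prems in auto)
    then show ?thesis unfolding c using 2 fin by (simp add: sum.remove[of H h])
  next
    case 3
    then obtain m where c: "card (R - {r}) = m" "card R = Suc m"
      using card_Suc_Diff1[OF fin(2), of r] by metis
    have "(\<Sum>h\<in>H. card {r' \<in> R. E h r'})
        = (\<Sum>h\<in>H. card {r' \<in> R - {r}. E h r'} + (if E r h then 1 else 0))"
    proof (rule sum.cong[OF refl])
      fix h
      have "{r' \<in> R. E h r'} = (if E r h then insert r {r' \<in> R - {r}. E h r'} else {r' \<in> R - {r}. E h r'})"
        using 3 sym by auto
      then show "card {r' \<in> R. E h r'} = card {r' \<in> R - {r}. E h r'} + (if E r h then 1 else 0)"
        using fin by simp
    qed
    also have "\<dots> = (\<Sum>h\<in>H. card {r' \<in> R - {r}. E h r'}) + card {h \<in> H. E r h}"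
      using fin by (simp add: sum.distrib sum.If_cases Int_def)
    also have "(\<Sum>h\<in>H. card {r' \<in> R - {r}. E h r'}) \<le> (3 * k + 2) * card H + (k - 1) * card (R - {r})"
      by (rule less.hyps) (use c less.prems in auto)
    finally show ?thesis using 3 unfolding c by simp
  qed
qed

section \<open>The biclique forced by a large eigenvalue\<close>

lemma sum_symmetric_swap:
  fixes f :: "'a \<Rightarrow> 'a \<Rightarrow> 'b :: comm_monoid_add"
  assumes "finite Z" "\<And>u v. E u v \<Longrightarrow> E v u"
  shows "(\<Sum>u\<in>Z. \<Sum>v | v \<in> Z \<and> E u v. f u v) = (\<Sum>v\<in>Z. \<Sum>u | u \<in> Z \<and> E v u. f u v)"
proof -
  have "E u v = E v u" for u v using assms(2) by blast
  then show ?thesis using sum.swap_restrict[OF assms(1) assms(1), of f E] by simp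
qed

lemma sum_degree_weighted:
  fixes x :: "'a \<Rightarrow> real"
  assumes Z: "finite Z" and sym: "\<And>u v. E u v \<Longrightarrow> E v u"
    and eig: "\<And>v. v \<in> Z \<Longrightarrow> (\<Sum>u | u \<in> Z \<and> E v u. x u) = l * x v"
  shows "(\<Sum>v\<in>Z. real (card {u \<in> Z. E v u}) * x v) = l * (\<Sum>v\<in>Z. x v)"
proof -
  have "(\<Sum>v\<in>Z. real (card {u \<in> Z. E v u}) * x v) = (\<Sum>v\<in>Z. \<Sum>u | u \<in> Z \<and> E v u. x v)" by simp
  also have "\<dots> = (\<Sum>u\<in>Z. \<Sum>v | v \<in> Z \<and> E u v. x v)" by (rule sum_symmetric_swap[OF Z sym])
  also have "\<dots> = l * (\<Sum>v\<in>Z. x v)" using eig by (simp add: sum_distrib_left)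
  finally show ?thesis .
qed

text \<open>The row sums of \<open>A\<^sup>2 - (3k + 3) A\<close> are at most \<open>(k - 1) (n - 1)\<close>.\<close>

lemma biclique_free_eigenvalue_bound:
  fixes x :: "'a \<Rightarrow> real"
  assumes Z: "finite Z" and sym: "\<And>u v. E u v \<Longrightarrow> E v u" and irr: "\<And>v. \<not> E v v" and k: "k \<ge> 1"
    and no_path: "\<not> has_path Z E (2 * k + 3)" and no_bic: "\<not> has_biclique Z E k (k + 3)"
    and pos: "\<And>v. v \<in> Z \<Longrightarrow> 0 < x v" and ne: "Z \<noteq> {}"
    and eig: "\<And>v. v \<in> Z \<Longrightarrow> (\<Sum>u | u \<in> Z \<and> E v u. x u) = l * x v"
  shows "l\<^sup>2 - (3 * real k + 3) * l \<le> (real k - 1) * (real (card Z) - 1)"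
proof -
  define d where "d v = card {u \<in> Z. E v u}" for v
  define s where "s = (\<Sum>v\<in>Z. x v)"
  have s: "s > 0" unfolding s_def using Z ne pos by (intro sum_pos) auto
  \<comment> \<open>The edge bound is applied to the neighbours of \<open>u\<close> against
    \<open>Z - {u}\<close>, which contains them. Counting \<open>u\<close> itself in each
    neighbour's degree raises \<open>3 * k + 2\<close> to \<open>3 * k + 3\<close>.\<close>
  have row: "(\<Sum>v | v \<in> Z \<and> E u v. real (d v)) \<le> (3 * real k + 3) * real (d u) + (real k - 1) * (real (card Z) - 1)"
    if u: "u \<in> Z" for u
  proof -
    have "(\<Sum>v | v \<in> Z \<and> E u v. d v) = (\<Sum>v | v \<in> Z \<and> E u v. card {w \<in> Z - {u}. E v w} + 1)"
    proof (rule sum.cong[OF refl])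
      fix v assume "v \<in> {v. v \<in> Z \<and> E u v}"
      then have "{w \<in> Z. E v w} = insert u {w \<in> Z - {u}. E v w}" using sym u by auto
      then show "d v = card {w \<in> Z - {u}. E v w} + 1" using Z by (simp add: d_def)
    qed
    also have "\<dots> = (\<Sum>v | v \<in> Z \<and> E u v. card {w \<in> Z - {u}. E v w}) + d u"
      unfolding sum.distrib by (simp add: d_def)
    also have "\<dots> \<le> (3 * k + 2) * d u + (k - 1) * card (Z - {u}) + d u"
      using biclique_free_edge_bound[OF Z sym irr k no_path no_bic, of "{v. v \<in> Z \<and> E u v}" "Z - {u}"]
      unfolding d_def by auto
    finally have "real (\<Sum>v | v \<in> Z \<and> E u v. d v)
        \<le> real ((3 * k + 2) * d u + (k - 1) * card (Z - {u}) + d u)" by (rule of_nat_mono)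
    moreover have "real (card (Z - {u})) = real (card Z) - 1"
      using u Z ne by (simp add: card_Diff_singleton of_nat_diff card_gt_0_iff Suc_le_eq)
    moreover obtain j where "k = Suc j" using k by (cases k) auto
    ultimately show ?thesis by (simp add: algebra_simps)
  qed
  have "l * (l * s) = l * (\<Sum>v\<in>Z. real (d v) * x v)"
    using sum_degree_weighted[OF Z sym eig] by (simp add: s_def d_def)
  also have "\<dots> = (\<Sum>v\<in>Z. \<Sum>u | u \<in> Z \<and> E v u. real (d v) * x u)"
    by (simp add: sum_distrib_left eig mult.left_commute flip: sum_distrib_left)
  also have "\<dots> = (\<Sum>u\<in>Z. \<Sum>v | v \<in> Z \<and> E u v. real (d v) * x u)"
    by (rule sum_symmetric_swap[OF Z sym])
  also have "\<dots> = (\<Sum>u\<in>Z. (\<Sum>v | v \<in> Z \<and> E u v. real (d v)) * x u)"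
    by (simp add: sum_distrib_right)
  also have "\<dots> \<le> (\<Sum>u\<in>Z. ((3 * real k + 3) * real (d u) + (real k - 1) * (real (card Z) - 1)) * x u)"
    using row pos by (intro sum_mono mult_right_mono) (auto intro: less_imp_le)
  also have "\<dots> = (3 * real k + 3) * (\<Sum>u\<in>Z. real (d u) * x u) + (real k - 1) * (real (card Z) - 1) * s"
    by (simp add: s_def sum_distrib_left distrib_right sum.distrib mult.assoc)
  also have "(\<Sum>u\<in>Z. real (d u) * x u) = l * s"
    using sum_degree_weighted[OF Z sym eig] by (simp add: s_def d_def)
  finally have "(l\<^sup>2 - (3 * real k + 3) * l) * s \<le> ((real k - 1) * (real (card Z) - 1)) * s"
    by (simp add: algebra_simps power2_eq_square)
  then show ?thesis using s by simp
qed

text \<open>What the biclique argument takes from the size of \<open>n\<close> when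
  \<open>k \<ge> 2\<close>. Equality holds at \<open>k = 2\<close>; from there each step multiplies
  the left side by at most 8 and the right side by 16.\<close>

lemma pow_16_ge_cubic:
  assumes "k \<ge> 2"
  shows "32 * k ^ 3 \<le> 2 ^ (4 * k :: nat)"
  using assms
proof (induction k rule: dec_induct)
  case base
  then show ?case by simp
next
  case (step k)
  have "Suc k ^ 3 \<le> (2 * k) ^ 3" using step by (intro power_mono) auto
  then show ?case using step by (simp add: power_mult_distrib power_add)
qed

text \<open>Here \<open>N\<close> is the order of the graph and \<open>m\<close> that of a
  component. Subtracting the bounds shows that \<open>l\<close> is at least of order
  \<open>N / K\<close>; once \<open>N\<close> is of order \<open>K ^ 3\<close>,
  \<open>l\<^sup>2\<close> exceeds \<open>K * N\<close> by too much for the upper bound.\<close>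

lemma eigenvalue_bounds_contradictory:
  fixes l K N m :: real
  assumes K: "K \<ge> 2" and N: "N \<ge> 32 * K ^ 3" and m: "m \<le> N" and l: "l > 0"
    and up: "l\<^sup>2 - (3 * K + 3) * l \<le> (K - 1) * (m - 1)"
    and low: "K * (N - K) \<le> l\<^sup>2 - (K - 1) * l"
  shows False
proof -
  have mN: "(K - 1) * (m - 1) \<le> (K - 1) * (N - 1)" using K m by (intro mult_left_mono) auto
  have K2: "2 * K \<le> K\<^sup>2" using K by (simp add: power2_eq_square)
  have K3: "2 * K\<^sup>2 \<le> K ^ 3" using K by (simp add: power2_eq_square power3_eq_cube)
  have "N - K\<^sup>2 \<le> (2 * K + 4) * l"
    using low up mN K by (simp add: algebra_simps power2_eq_square)
  also have "\<dots> \<le> 4 * K * l" using K l by (intro mult_right_mono) auto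
  \<comment> \<open>Uses \<open>K\<^sup>2 \<le> K ^ 3 / 2 \<le> N / 64\<close>.\<close>
  finally have l1: "63 * N \<le> 256 * (K * l)" using N K3 by simp
  then have "K * (63 * K\<^sup>2) \<le> K * (8 * l)"
    using N by (simp add: power2_eq_square power3_eq_cube mult.commute mult.left_commute)
  then have "63 * K\<^sup>2 \<le> 8 * l" using K by simp
  then have l2: "45 * K\<^sup>2 \<le> 8 * (l - (3 * K + 3))" using K2 K by simp
  have Npos: "N > 0" using N K by (smt (verit) zero_less_power)
  \<comment> \<open>The constants close up because \<open>63 * 45 = 2835\<close> exceeds
    \<open>256 * 8 = 2048\<close>.\<close>
  have "63 * N * (45 * K\<^sup>2) \<le> 256 * (K * l) * (8 * (l - (3 * K + 3)))"
    using mult_mono[OF l1 l2] K l by simp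
  then have "K * (63 * 45 * (K * N)) \<le> K * (2048 * (l * (l - (3 * K + 3))))"
    by (simp add: power2_eq_square algebra_simps)
  then have "63 * 45 * (K * N) \<le> 2048 * (l * (l - (3 * K + 3)))" using K by simp
  also have "\<dots> \<le> 2048 * ((K - 1) * (N - 1))"
    using up mN by (simp add: power2_eq_square algebra_simps)
  also have "\<dots> \<le> 2048 * (K * N)" using K Npos by (simp add: algebra_simps)
  finally show False using K Npos by simp
qed

text \<open>For \<open>k = 1\<close> the row-sum bound only gives \<open>l \<le> 6\<close>, which is
  compatible with \<open>n = 16\<close>. There the biclique is a star with four leaves: the weighted
  mean degree is \<open>l\<close>, and \<open>l\<^sup>2 \<ge> 15\<close> pushes it above 3.\<close>

lemma large_eigenvalue_has_biclique:
  fixes x :: "'a \<Rightarrow> real"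
  assumes Z: "finite Z" and sym: "\<And>u v. E u v \<Longrightarrow> E v u" and irr: "\<And>v. \<not> E v v" and k: "k \<ge> 1"
    and no_path: "\<not> has_path Z E (2 * k + 3)"
    and pos: "\<And>v. v \<in> Z \<Longrightarrow> 0 < x v" and ne: "Z \<noteq> {}"
    and eig: "\<And>v. v \<in> Z \<Longrightarrow> (\<Sum>u | u \<in> Z \<and> E v u. x u) = l * x v"
    and n: "n \<ge> 2 ^ (4 * k)" "card Z \<le> n" and l: "l > 0"
    and low: "real k * (real n - real k) \<le> l\<^sup>2 - (real k - 1) * l"
  shows "has_biclique Z E k (k + 3)"
proof (cases "k = 1")
  case True
  then have "l\<^sup>2 \<ge> 15" using low n by simp
  then have l3: "l > 3" using power_less_imp_less_base[of 3 2 l] l by simp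
  have "\<exists>v\<in>Z. 4 \<le> card {u \<in> Z. E v u}"
  proof (rule ccontr)
    assume "\<not> ?thesis"
    then have "card {u \<in> Z. E v u} \<le> 3" if "v \<in> Z" for v using that by force
    then have "(\<Sum>v\<in>Z. real (card {u \<in> Z. E v u}) * x v) \<le> (\<Sum>v\<in>Z. 3 * x v)"
      using pos by (intro sum_mono mult_right_mono) (auto intro: less_imp_le)
    then have "l * (\<Sum>v\<in>Z. x v) \<le> 3 * (\<Sum>v\<in>Z. x v)"
      using sum_degree_weighted[OF Z sym eig] by (simp add: sum_distrib_left)
    moreover have "(\<Sum>v\<in>Z. x v) > 0" using Z ne pos by (intro sum_pos) auto
    ultimately show False using l3 by simp
  qed
  then obtain v where v: "v \<in> Z" "4 \<le> card {u \<in> Z. E v u}" by blast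
  then show ?thesis
    unfolding has_biclique_def True using irr
    by (intro exI[of _ "{v}"] exI[of _ "{u \<in> Z. E v u}"]) auto
next
  case False
  then have k2: "k \<ge> 2" using k by simp
  have "32 * k ^ 3 \<le> n" using pow_16_ge_cubic[OF k2] n by linarith
  then have "real (32 * k ^ 3) \<le> real n" by (rule of_nat_mono)
  then have "32 * real k ^ 3 \<le> real n" by simp
  from eigenvalue_bounds_contradictory[OF _ this _ l _ low, of "real (card Z)"]
    biclique_free_eigenvalue_bound[OF Z sym irr k no_path _ pos ne eig] k2 n
  show ?thesis by auto
qed

section \<open>Graphs spanned by a biclique\<close>

text \<open>\<open>closed\<close> and \<open>connected\<close> make \<open>Z\<close> a component.
  The three spare vertices of \<open>T\<close> let an alternating path avoid the outside vertices
  glued to it: three if it uses \<open>k\<close> vertices of \<open>T\<close>, four if it uses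
  \<open>k - 1\<close>.\<close>

locale spanning_biclique =
  fixes Z :: "'a set" and E :: "'a \<Rightarrow> 'a \<Rightarrow> bool" and S T :: "'a set" and x :: "'a \<Rightarrow> real" and l :: real
  assumes Z: "finite Z" and sym: "\<And>u v. E u v \<Longrightarrow> E v u" and irr: "\<And>v. \<not> E v v"
    and closed: "\<And>u v. u \<in> Z \<Longrightarrow> E u v \<Longrightarrow> v \<in> Z"
    and connected: "\<And>W. W \<subseteq> Z \<Longrightarrow> W \<noteq> {} \<Longrightarrow> (\<And>u v. u \<in> W \<Longrightarrow> E u v \<Longrightarrow> v \<in> W) \<Longrightarrow> W = Z"
    and S: "S \<subseteq> Z" "S \<noteq> {}" and T: "T \<subseteq> Z" "S \<inter> T = {}" "card S + 3 \<le> card T"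
    and bic: "\<And>s t. s \<in> S \<Longrightarrow> t \<in> T \<Longrightarrow> E s t"
    and pos: "\<And>v. v \<in> Z \<Longrightarrow> 0 < x v" and l: "0 < l"
    and eig: "\<And>v. v \<in> Z \<Longrightarrow> (\<Sum>u | u \<in> Z \<and> E v u. x u) = l * x v"
begin

definition "k = card S"
definition "B = Z - S"
definition "sigma = (\<Sum>s\<in>S. x s)"
definition "att v \<longleftrightarrow> (\<exists>s\<in>S. E v s)"

lemma fin: "finite S" "finite T" "finite B"
  using finite_subset[OF S(1) Z] finite_subset[OF T(1) Z] Z by (auto simp: B_def)

lemma B_in_Z: "v \<in> B \<Longrightarrow> v \<in> Z" by (simp add: B_def)

lemma k: "k \<ge> 1" using S fin by (simp add: k_def Suc_le_eq card_gt_0_iff)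

lemma card_B: "card B = card Z - k" "k \<le> card Z"
  using S Z fin by (auto simp: B_def k_def card_Diff_subset card_mono)

lemma real_card_B: "real (card B) = real (card Z) - real k"
  using card_B by (simp add: of_nat_diff)

lemma sigma_pos: "sigma > 0"
  unfolding sigma_def using fin S pos by (intro sum_pos) auto

section \<open>Alternating paths through \<open>S\<close> and \<open>T\<close>\<close>

lemma card_T_minus: "k + 3 \<le> card (T - X) + card X" if "finite X"
proof -
  have "card T \<le> card ((T - X) \<union> X)" using fin that by (intro card_mono) auto
  also have "\<dots> \<le> card (T - X) + card X" by (rule card_Un_le)
  finally show ?thesis using T by (simp add: k_def)
qed

text \<open>Generalised over the forbidden set \<open>X\<close>, which absorbs each vertex of
  \<open>T\<close> as it is used. Both ends are recorded so that paths can be glued on at either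
  side.\<close>

lemma alternating_path:
  assumes "distinct ss" "set ss \<subseteq> S" "length ss \<le> card (T - X)"
  shows "\<exists>zs. length zs = 2 * length ss \<and> distinct zs \<and> set zs \<subseteq> set ss \<union> (T - X) \<and>
    successively E zs \<and> (ss \<noteq> [] \<longrightarrow> hd zs = hd ss \<and> last zs \<in> T)"
  using assms
proof (induction ss arbitrary: X)
  case Nil
  show ?case by (intro exI[of _ "[]"]) simp
next
  case (Cons s ss)
  then have "T - X \<noteq> {}" by force
  then obtain t where t: "t \<in> T" "t \<notin> X" by blast
  have "T - insert t X = (T - X) - {t}" by blast
  then have "length ss \<le> card (T - insert t X)" using Cons.prems t by simp
  then obtain zs where zs: "length zs = 2 * length ss" "distinct zs"
    "set zs \<subseteq> set ss \<union> (T - insert t X)" "successively E zs"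
    "ss \<noteq> [] \<longrightarrow> hd zs = hd ss \<and> last zs \<in> T"
    using Cons by force
  have "successively E (s # t # zs)"
    using zs bic[OF _ t(1)] sym Cons.prems by (cases ss) (auto simp: successively_Cons)
  moreover have "distinct (s # t # zs)"
    using zs(2,3) Cons.prems t T(2) by auto
  ultimately show ?case
    using zs t by (intro exI[of _ "s # t # zs"]) (cases ss; auto)
qed

lemma enumerate_S:
  assumes "S' \<subseteq> S" "s \<in> S'"
  obtains ss where "distinct (s # ss)" "set (s # ss) = S'" "length (s # ss) = card S'"
proof -
  have f: "finite S'" using assms fin finite_subset by blast
  then obtain ss where "set ss = S' - {s}" "distinct ss"
    using finite_distinct_list[of "S' - {s}"] by auto
  then show thesis using that[of ss] assms f distinct_card[of "s # ss"] by (auto simp: insert_absorb)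
qed

text \<open>An alternating path through all of \<open>S\<close> continues \<open>ps\<close>. Two or
  three vertices outside \<open>S\<close> thus already produce the forbidden paths of (a) and
  (b).\<close>

lemma attached_path:
  assumes ps: "distinct ps" "set ps \<subseteq> B" "successively E ps" "ps \<noteq> []" "length ps \<le> 3"
    and att: "att (last ps)"
  shows "has_path Z E (length ps + 2 * k)"
proof -
  obtain s where s: "s \<in> S" "E (last ps) s" using att by (auto simp: att_def)
  obtain ss where ss: "distinct (s # ss)" "set (s # ss) = S" "length (s # ss) = k"
    using enumerate_S[OF subset_refl s(1)] by (auto simp: k_def)
  have "k \<le> card (T - set ps)"
    using card_T_minus[of "set ps"] card_length[of ps] ps(5) by simp
  then have c: "set (s # ss) \<subseteq> S" "length (s # ss) \<le> card (T - set ps)" using ss by auto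
  obtain zs where zs: "length zs = 2 * length (s # ss)" "distinct zs"
    "set zs \<subseteq> set (s # ss) \<union> (T - set ps)" "successively E zs"
    "s # ss \<noteq> [] \<Longrightarrow> hd zs = hd (s # ss)"
    using alternating_path[OF ss(1) c] by blast
  have "successively E (ps @ zs)"
    using ps zs s by (simp add: successively_append_iff)
  moreover have "set ps \<inter> set zs = {}" using zs(3) ps(2) ss(2) by (auto simp: B_def)
  moreover have "set (ps @ zs) \<subseteq> Z" using zs(3) ps(2) S T ss(2) by (auto simp: B_def)
  ultimately show ?thesis
    unfolding has_path_iff using ps zs(1,2) ss(3) by (intro exI[of _ "ps @ zs"]) simp
qed

text \<open>The path is \<open>u', u, s, ..., s', v, v'\<close> with an alternating stretch over
  \<open>S - {s'}\<close>, in all \<open>2 + 2 * (k - 1) + 3\<close> vertices. If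
  \<open>S = {s}\<close>, the stretch is empty and \<open>u\<close> is followed by \<open>s'\<close>
  directly.\<close>

lemma two_edges_path:
  assumes d: "distinct [u', u, v, v']" "{u', u, v, v'} \<subseteq> B"
    and e: "E u' u" "E u s" "E v s'" "E v v'" and s: "s \<in> S" "s' \<in> S" "s \<noteq> s' \<or> S = {s}"
  shows "has_path Z E (2 * k + 3)"
proof -
  define X where "X = {u', u, v, v'}"
  have kX: "k - 1 \<le> card (T - X)"
    using card_T_minus[of X] card_length[of "[u', u, v, v']"] by (simp add: X_def)
  obtain ss where ss: "distinct ss" "set ss = S - {s'}" "length ss = k - 1" "ss \<noteq> [] \<longrightarrow> hd ss = s"
  proof (cases "s = s'")
    case True
    then show thesis using that[of "[]"] s by (auto simp: k_def)
  next
    case False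
    then show thesis
      using enumerate_S[of "S - {s'}" s] s fin that by (metis Diff_iff Diff_subset card_Diff_singleton k_def list.sel(1) singletonD)
  qed
  have c: "set ss \<subseteq> S" "length ss \<le> card (T - X)" using ss kX by auto
  obtain zs where zs: "length zs = 2 * length ss" "distinct zs" "set zs \<subseteq> set ss \<union> (T - X)"
    "successively E zs" "ss \<noteq> [] \<Longrightarrow> hd zs = hd ss" "ss \<noteq> [] \<Longrightarrow> last zs \<in> T"
    using alternating_path[OF ss(1) c] by blast
  have path: "successively E (zs @ [s', v, v'])" "E u (hd (zs @ [s', v, v']))"
  proof -
    have "E (last zs) s'" if "zs \<noteq> []"
      using that zs(1) sym[OF bic[OF s(2) zs(6)]] by (cases "ss = []") auto
    then show "successively E (zs @ [s', v, v'])"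
      using zs(4) e(4) sym[OF e(3)] by (cases "zs = []") (simp_all add: successively_append_iff)
    show "E u (hd (zs @ [s', v, v']))"
    proof (cases "zs = []")
      case True
      then have "S - {s'} = {}" using zs(1) ss by auto
      then have "S = {s'}" using s by auto
      then show ?thesis using True s e by auto
    next
      case False
      then have "ss \<noteq> []" using zs(1) by auto
      then show ?thesis using False zs(5) ss(4) e by simp
    qed
  qed
  define P where "P = u' # u # zs @ [s', v, v']"
  have "successively E P"
    using path e(1) by (simp add: P_def successively_Cons)
  moreover have "distinct P"
    using d zs(2,3) ss(2) s(2) T(2) by (auto simp: P_def X_def B_def)
  moreover have "set P \<subseteq> Z" using d(2) zs(3) ss(2) S T s by (auto simp: P_def B_def)
  moreover have "length P = 2 * k + 3" using zs(1) ss(3) k by (simp add: P_def)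
  ultimately show ?thesis unfolding has_path_iff by blast
qed

section \<open>The eigenvalue equation summed over \<open>S\<close>\<close>

lemma eig_split:
  assumes "v \<in> Z"
  shows "l * x v = (\<Sum>s | s \<in> S \<and> E v s. x s) + (\<Sum>u | u \<in> B \<and> E v u. x u)"
proof -
  have "{u. u \<in> Z \<and> E v u} = {s. s \<in> S \<and> E v s} \<union> {u. u \<in> B \<and> E v u}"
    using S by (auto simp: B_def)
  then have "(\<Sum>u | u \<in> Z \<and> E v u. x u) = (\<Sum>s | s \<in> S \<and> E v s. x s) + (\<Sum>u | u \<in> B \<and> E v u. x u)"
    using fin by (simp add: sum.union_disjoint B_def disjoint_iff)
  then show ?thesis using eig[OF assms] by simp
qed

lemma S_part_le: "(\<Sum>s | s \<in> S \<and> E v s. x s) \<le> sigma"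
  unfolding sigma_def using fin S pos by (intro sum_mono2) (auto intro: less_imp_le)

text \<open>Inside \<open>S\<close> the estimate is that of a clique. The number of
  \<open>S\<close>-neighbours of each outside vertex is kept, because having few of them is what
  later compensates for an isolated outside edge.\<close>

lemma sigma_bound:
  "l * sigma \<le> (real k - 1) * sigma + (\<Sum>v\<in>B. real (card {s \<in> S. E v s}) * x v)"
proof -
  have "l * sigma = (\<Sum>s\<in>S. \<Sum>s' | s' \<in> S \<and> E s s'. x s') + (\<Sum>s\<in>S. \<Sum>u | u \<in> B \<and> E s u. x u)"
    using S by (simp add: sigma_def sum_distrib_left eig_split subset_iff sum.distrib)
  also have "(\<Sum>s\<in>S. \<Sum>u | u \<in> B \<and> E s u. x u) = (\<Sum>u\<in>B. \<Sum>s | s \<in> S \<and> E u s. x u)"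
  proof -
    have "E s u = E u s" for s u using sym by blast
    then show ?thesis using sum.swap_restrict[OF fin(1,3), of "\<lambda>s u. x u" E] by simp
  qed
  also have "\<dots> = (\<Sum>v\<in>B. real (card {s \<in> S. E v s}) * x v)" by simp
  also have "(\<Sum>s\<in>S. \<Sum>s' | s' \<in> S \<and> E s s'. x s') \<le> (\<Sum>s\<in>S. sigma - x s)"
  proof (rule sum_mono)
    fix s assume s: "s \<in> S"
    have "(\<Sum>s' | s' \<in> S \<and> E s s'. x s') \<le> (\<Sum>s'\<in>S - {s}. x s')"
      using fin S pos irr by (intro sum_mono2) (auto intro: less_imp_le)
    then show "(\<Sum>s' | s' \<in> S \<and> E s s'. x s') \<le> sigma - x s"
      using s fin by (simp add: sigma_def sum_diff1)
  qed
  also have "(\<Sum>s\<in>S. sigma - x s) = (real k - 1) * sigma"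
    by (simp add: sum_subtractf k_def sigma_def algebra_simps)
  finally show ?thesis by simp
qed

text \<open>\<open>gap s\<close> is the weight of the vertices missing from the neighbourhood of
  \<open>s\<close>. The gaps add up to the deficit in the summed equation, and since weights are
  positive, zero deficit means that nothing is missing.\<close>

lemma sigma_bound_equality:
  shows "l * sigma \<le> (real k - 1) * sigma + real k * (\<Sum>v\<in>B. x v)"
    and "l * sigma = (real k - 1) * sigma + real k * (\<Sum>v\<in>B. x v) \<Longrightarrow>
      s \<in> S \<Longrightarrow> v \<in> Z \<Longrightarrow> v \<noteq> s \<Longrightarrow> E s v"
proof -
  define gap where "gap s = (\<Sum>u | u \<in> Z - {s} \<and> \<not> E s u. x u)" for s
  have gap_nonneg: "gap s \<ge> 0" for s
    unfolding gap_def using pos by (intro sum_nonneg) (auto intro: less_imp_le)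
  have tot: "(\<Sum>u\<in>Z. x u) = sigma + (\<Sum>v\<in>B. x v)"
    using sum.subset_diff[OF S(1) Z, of x] by (simp add: sigma_def B_def)
  have "l * x s + gap s = sigma + (\<Sum>v\<in>B. x v) - x s" if s: "s \<in> S" for s
  proof -
    have sZ: "s \<in> Z" using s S by auto
    have "l * x s + gap s = (\<Sum>u \<in> {u. u \<in> Z \<and> E s u} \<union> {u. u \<in> Z - {s} \<and> \<not> E s u}. x u)"
      using Z eig[OF sZ] by (subst sum.union_disjoint) (auto simp: gap_def)
    also have "{u. u \<in> Z \<and> E s u} \<union> {u. u \<in> Z - {s} \<and> \<not> E s u} = Z - {s}" using irr by auto
    finally show ?thesis using Z sZ tot by (simp add: sum_diff1)
  qed
  then have "(\<Sum>s\<in>S. l * x s + gap s) = (\<Sum>s\<in>S. sigma + (\<Sum>v\<in>B. x v) - x s)" by (intro sum.cong) auto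
  then have key: "l * sigma + (\<Sum>s\<in>S. gap s) = (real k - 1) * sigma + real k * (\<Sum>v\<in>B. x v)"
    by (simp add: sum.distrib sum_subtractf k_def algebra_simps sigma_def flip: sum_distrib_left)
  then show "l * sigma \<le> (real k - 1) * sigma + real k * (\<Sum>v\<in>B. x v)"
    using sum_nonneg[of S gap] gap_nonneg by simp
  assume eq: "l * sigma = (real k - 1) * sigma + real k * (\<Sum>v\<in>B. x v)"
    and sv: "s \<in> S" "v \<in> Z" "v \<noteq> s"
  show "E s v"
  proof (rule ccontr)
    assume "\<not> E s v"
    then have "gap s > 0"
      unfolding gap_def using sv Z pos by (intro sum_pos2[of _ v]) (auto intro: less_imp_le)
    then have "(\<Sum>s\<in>S. gap s) > 0" using sv fin gap_nonneg by (intro sum_pos2[of _ s]) auto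
    then show False using key eq by simp
  qed
qed

text \<open>An attached vertex with a neighbour outside \<open>S\<close> would start a path on
  \<open>2 * k + 2\<close> vertices. So \<open>S\<close> with the attached vertices is closed under
  adjacency, hence all of \<open>Z\<close>.\<close>

lemma independent_complement:
  assumes no_path: "\<not> has_path Z E (2 * k + 2)" and uv: "u \<in> B" "v \<in> B"
  shows "\<not> E u v"
proof -
  have no: "\<not> E a b" if "att a" "a \<in> B" "b \<in> B" for a b
    using attached_path[of "[b, a]"] that no_path sym irr by auto
  define W where "W = S \<union> {v \<in> B. att v}"
  have "W = Z"
  proof (rule connected)
    show "W \<subseteq> Z" "W \<noteq> {}" using S by (auto simp: W_def B_def)
    show "b \<in> W" if "a \<in> W" "E a b" for a b
      using that no[of a b] S closed sym unfolding W_def B_def att_def by blast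
  qed
  then have "att u" using uv by (auto simp: W_def B_def)
  then show ?thesis using no uv by blast
qed

text \<open>Each outside vertex has weight at most \<open>sigma / l\<close>; inserted in the summed
  equation, this cancels \<open>sigma\<close>. Equality for \<open>l\<close> carries back to
  \<open>sigma_bound_equality\<close>.\<close>

lemma eigenvalue_bound_independent:
  assumes indep: "\<forall>u\<in>B. \<forall>v\<in>B. \<not> E u v"
  shows "l\<^sup>2 - (real k - 1) * l \<le> real k * (real (card Z) - real k)"
    and "l\<^sup>2 - (real k - 1) * l = real k * (real (card Z) - real k) \<Longrightarrow>
      s \<in> S \<Longrightarrow> v \<in> Z \<Longrightarrow> v \<noteq> s \<Longrightarrow> E s v"
proof -
  have "l * x v \<le> sigma" if "v \<in> B" for v
  proof -
    have "(\<Sum>u | u \<in> B \<and> E v u. x u) = 0" using indep that by (intro sum.neutral) auto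
    then show ?thesis using eig_split[OF B_in_Z[OF that]] S_part_le[of v] by linarith
  qed
  then have "(\<Sum>v\<in>B. l * x v) \<le> (\<Sum>v\<in>B. sigma)" by (rule sum_mono)
  then have sumB: "l * (\<Sum>v\<in>B. x v) \<le> (real (card Z) - real k) * sigma"
    by (simp add: sum_distrib_left real_card_B)
  have 1: "l * (l * sigma) \<le> l * ((real k - 1) * sigma + real k * (\<Sum>v\<in>B. x v))"
    using sigma_bound_equality(1) l by simp
  have 2: "real k * (l * (\<Sum>v\<in>B. x v)) \<le> real k * ((real (card Z) - real k) * sigma)"
    using sumB by (intro mult_left_mono) auto
  have "(l\<^sup>2 - (real k - 1) * l) * sigma \<le> (real k * (real (card Z) - real k)) * sigma"
    using 1 2 by (simp add: algebra_simps power2_eq_square)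
  then show "l\<^sup>2 - (real k - 1) * l \<le> real k * (real (card Z) - real k)"
    using sigma_pos by simp
  assume eq: "l\<^sup>2 - (real k - 1) * l = real k * (real (card Z) - real k)"
    and sv: "s \<in> S" "v \<in> Z" "v \<noteq> s"
  have "(l\<^sup>2 - (real k - 1) * l) * sigma = (real k * (real (card Z) - real k)) * sigma"
    using eq by simp
  then have "l * ((real k - 1) * sigma + real k * (\<Sum>v\<in>B. x v)) \<le> l * (l * sigma)"
    using 2 by (simp add: algebra_simps power2_eq_square)
  then have "l * sigma = (real k - 1) * sigma + real k * (\<Sum>v\<in>B. x v)"
    using l sigma_bound_equality(1) by simp
  then show "E s v" using sigma_bound_equality(2) sv by blast
qed

text \<open>The ends of the edge satisfy \<open>(l - 1) * (x w + x w') \<le> 2 * sigma\<close>, the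
  other outside vertices behave as in the independent case. Clearing denominators gives the cubic of
  \<open>S_plus_graph_eigenvalue\<close>.\<close>

lemma eigenvalue_bound_one_edge:
  assumes w: "w \<in> B" "w' \<in> B" "w \<noteq> w'" and l1: "l > 1"
    and only: "\<forall>u\<in>B. \<forall>v\<in>B. E u v \<longrightarrow> {u, v} = {w, w'}"
  shows "(l\<^sup>2 - (real k - 1) * l - real k * (real (card Z) - real k)) * (l - 1) \<le> 2 * real k"
    and "(l\<^sup>2 - (real k - 1) * l - real k * (real (card Z) - real k)) * (l - 1) = 2 * real k \<Longrightarrow>
      s \<in> S \<Longrightarrow> v \<in> Z \<Longrightarrow> v \<noteq> s \<Longrightarrow> E s v"
proof -
  define X where "X = (\<Sum>v\<in>B. x v)"
  define r where "r = real (card Z) - real k"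
  have others: "l * x v \<le> sigma" if "v \<in> B - {w, w'}" for v
  proof -
    have v: "v \<in> B" using that by simp
    have "(\<Sum>u | u \<in> B \<and> E v u. x u) = 0" using only that by (intro sum.neutral) blast
    then show ?thesis using eig_split[OF B_in_Z[OF v]] S_part_le[of v] by linarith
  qed
  have pair: "l * x a \<le> sigma + x b" if "{a, b} = {w, w'}" for a b
  proof -
    have a: "a \<in> B" "b \<in> B" "a \<noteq> b" using that w by (auto simp: doubleton_eq_iff)
    have "{u. u \<in> B \<and> E a u} \<subseteq> {b}" using only that a irr by (auto simp: doubleton_eq_iff)
    then have "(\<Sum>u | u \<in> B \<and> E a u. x u) \<le> (\<Sum>u\<in>{b}. x u)"
      using pos a by (intro sum_mono2) (auto simp: B_def intro: less_imp_le)
    then show ?thesis using eig_split[of a] S_part_le[of a] a B_in_Z by simp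
  qed
  have pair_sum: "(l - 1) * (x w + x w') \<le> 2 * sigma"
    using pair[of w w'] pair[of w' w] by (simp add: algebra_simps insert_commute)
  have card2: "real (card (B - {w, w'})) = r - 2"
  proof -
    have "card {w, w'} \<le> card B" using w fin by (intro card_mono) auto
    then show ?thesis using w fin by (simp add: card_Diff_subset of_nat_diff r_def real_card_B)
  qed
  have "(\<Sum>v\<in>B - {w, w'}. l * x v) \<le> (\<Sum>v\<in>B - {w, w'}. sigma)" using others by (rule sum_mono)
  then have others_sum: "l * (\<Sum>v\<in>B - {w, w'}. x v) \<le> (r - 2) * sigma"
    by (simp add: sum_distrib_left card2)
  have X_split: "X = (\<Sum>v\<in>B - {w, w'}. x v) + (x w + x w')"
    unfolding X_def using sum.subset_diff[of "{w, w'}" B x] w fin by simp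
  have "(l - 1) * (l * (\<Sum>v\<in>B - {w, w'}. x v)) \<le> (l - 1) * ((r - 2) * sigma)"
    using others_sum l1 by (intro mult_left_mono) auto
  moreover have "l * ((l - 1) * (x w + x w')) \<le> l * (2 * sigma)"
    using pair_sum l by (intro mult_left_mono) auto
  ultimately have "l * (l - 1) * X \<le> ((r - 2) * (l - 1) + 2 * l) * sigma"
    unfolding X_split by (simp add: algebra_simps)
  then have 2: "real k * (l * (l - 1) * X) \<le> real k * (((r - 2) * (l - 1) + 2 * l) * sigma)"
    by (intro mult_left_mono) auto
  have 1: "l * (l - 1) * (l * sigma) \<le> l * (l - 1) * ((real k - 1) * sigma + real k * X)"
    using sigma_bound_equality(1) l l1 by (simp add: X_def)
  \<comment> \<open>By \<open>(r - 2) * (l - 1) + 2 * l = r * (l - 1) + 2\<close>; the final 2 is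
    the effect of the edge.\<close>
  have "((l\<^sup>2 - (real k - 1) * l - real k * r) * (l - 1)) * sigma \<le> (2 * real k) * sigma"
    using 1 2 by (simp add: algebra_simps power2_eq_square)
  then show "(l\<^sup>2 - (real k - 1) * l - real k * (real (card Z) - real k)) * (l - 1) \<le> 2 * real k"
    using sigma_pos by (simp add: r_def)
  assume eq: "(l\<^sup>2 - (real k - 1) * l - real k * (real (card Z) - real k)) * (l - 1) = 2 * real k"
    and sv: "s \<in> S" "v \<in> Z" "v \<noteq> s"
  have "((l\<^sup>2 - (real k - 1) * l - real k * r) * (l - 1)) * sigma = (2 * real k) * sigma"
    using eq by (simp add: r_def)
  then have "l * (l - 1) * ((real k - 1) * sigma + real k * X) \<le> l * (l - 1) * (l * sigma)"
    using 2 by (simp add: algebra_simps power2_eq_square)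
  then have "(real k - 1) * sigma + real k * X \<le> l * sigma" using l l1 by simp
  then have "l * sigma = (real k - 1) * sigma + real k * X"
    using sigma_bound_equality(1) by (simp add: X_def)
  then show "E s v" using sigma_bound_equality(2) sv by (simp add: X_def)
qed

text \<open>Every component of the graph outside \<open>S\<close> is a star whose centre alone is attached to \<open>S\<close>, or
  an edge; and if there are two edges outside \<open>S\<close> that share no vertex, then all their
  attached ends see the same single vertex of \<open>S\<close>. A star with \<open>r\<close> leaves then carries at most
  as much weight as \<open>r + 1\<close> isolated vertices joined to all of \<open>S\<close>.\<close>

lemma eigenvalue_bound_many_edges:
  assumes no_path: "\<not> has_path Z E (2 * k + 3)"
    and many: "\<forall>w\<in>B. \<forall>w'\<in>B. E w w' \<longrightarrow>
      (\<exists>u\<in>B. \<exists>v\<in>B. E u v \<and> {u, v} \<noteq> {w, w'})"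
    and l2: "l \<ge> 2" and lB: "real (card Z) - real k \<le> l\<^sup>2"
  shows "l\<^sup>2 - (real k - 1) * l \<le> real k * (real (card Z) - real k)"
proof -
  \<comment> \<open>Otherwise \<open>a, d, c\<close> continued through \<open>S\<close> has
    \<open>2 * k + 3\<close> vertices. So an outside neighbour of an attached vertex has no other
    outside neighbour.\<close>
  have cherry: "a = c" if "att c" "c \<in> B" "d \<in> B" "a \<in> B" "E c d" "E d a" for a c d
  proof (rule ccontr)
    assume "a \<noteq> c"
    moreover have "a \<noteq> d" "d \<noteq> c" using that irr by auto
    ultimately have "has_path Z E (length [a, d, c] + 2 * k)"
      using that sym by (intro attached_path) auto
    moreover have "length [a, d, c] + 2 * k = 2 * k + 3" by simp
    ultimately show False using no_path by metis
  qed
  define W where "W = S \<union> {v \<in> B. att v} \<union> {v \<in> B. \<exists>w\<in>B. att w \<and> E w v}"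
  have "W = Z"
  proof (rule connected)
    show "W \<subseteq> Z" "W \<noteq> {}" using S by (auto simp: W_def B_def)
    fix a b assume ab: "a \<in> W" "E a b"
    then have "b \<in> Z" "a \<in> Z" using closed S by (auto simp: W_def B_def)
    then have b: "b \<in> S \<or> b \<in> B" by (auto simp: B_def)
    consider "a \<in> S" | "a \<in> B" "att a" | w where "a \<in> B" "w \<in> B" "att w" "E w a"
      using ab by (auto simp: W_def)
    then show "b \<in> W"
    proof cases
      case 1
      then show ?thesis using b ab(2) sym by (auto simp: W_def att_def)
    next
      case 2
      then show ?thesis using b ab(2) by (auto simp: W_def)
    next
      case 3
      then show ?thesis using b ab(2) cherry[of w a b] by (auto simp: W_def)
    qed
  qed
  then have reach: "att v \<or> (\<exists>w\<in>B. att w \<and> E w v)" if "v \<in> B" for v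
    using that by (auto simp: W_def B_def)
  define leaves where "leaves w = {u \<in> B. E w u \<and> \<not> att u}" for w
  \<comment> \<open>A charging scheme: every outside vertex pays \<open>k * sigma / l\<close>, its
    share in the independent case, and an attached \<open>w\<close> collects from itself and its
    unattached neighbours.\<close>
  have weight: "real (card {s \<in> S. E w s}) * x w \<le> real k * sigma * (1 + real (card (leaves w))) / l"
    if w: "w \<in> B" "att w" for w
  proof (cases "\<exists>w'\<in>B. att w' \<and> E w w'")
    case True
    then obtain w' where w': "w' \<in> B" "att w'" "E w w'" by blast
    have nb: "{u. u \<in> B \<and> E w u} = {w'}" "{u. u \<in> B \<and> E w' u} = {w}"
      using cherry[of w' w] cherry[of w w'] w w' sym by blast+
    \<comment> \<open>The edge \<open>w w'\<close> is a whole component outside \<open>S\<close>, so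
      a second edge is disjoint from it; by \<open>cherry\<close> that edge has an attached end,
      called \<open>u\<close>.\<close>
    obtain u u' where u: "u \<in> B" "u' \<in> B" "E u' u" "{u, u'} \<noteq> {w, w'}" "att u"
    proof -
      obtain a b where ab: "a \<in> B" "b \<in> B" "E a b" "{a, b} \<noteq> {w, w'}"
        using bspec[OF bspec[OF many w(1)] w'(1)] w'(3) by metis
      have "att a \<or> att b" using reach[OF ab(1)] cherry[of _ a b] ab by blast
      then show thesis using that[of a b] that[of b a] ab sym by (auto simp: insert_commute)
    qed
    have uu: "E u u'" using sym u(3) by blast
    have N: "v = w'" if "v \<in> B" "E w v" for v using nb(1) that by blast
    have N': "v = w" if "v \<in> B" "E w' v" for v using nb(2) that by blast
    have "u \<noteq> w" using N[of u'] u(2,4) uu by auto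
    moreover have "u \<noteq> w'" using N'[of u'] u(2,4) uu by auto
    moreover have "u' \<noteq> w" using N[of u] u(1,3,4) by auto
    moreover have "u' \<noteq> w'" using N'[of u] u(1,3,4) by auto
    moreover have "u \<noteq> u'" "w \<noteq> w'" using irr uu w'(3) by auto
    ultimately have disj: "distinct [u', u, w, w']" "distinct [u', u, w', w]" by auto
    obtain s where s: "s \<in> S" "E u s" using u by (auto simp: att_def)
    \<comment> \<open>Any other situation would allow \<open>two_edges_path\<close>. Hence
      \<open>w\<close> and \<open>w'\<close> both see just \<open>s\<close>, and \<open>S\<close>
      has a second vertex.\<close>
    have only_s: "s' = s \<and> S \<noteq> {s}" if "s' \<in> S" "E w s' \<or> E w' s'" for s'
    proof (rule ccontr)
      assume "\<not> ?thesis"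
      then have ss: "s \<noteq> s' \<or> S = {s}" by blast
      from that(2) show False
      proof
        assume "E w s'"
        from two_edges_path[OF disj(1) _ u(3) s(2) this w'(3) s(1) that(1) ss]
        show False using u w w' no_path by simp
      next
        assume "E w' s'"
        from two_edges_path[OF disj(2) _ u(3) s(2) this sym[OF w'(3)] s(1) that(1) ss]
        show False using u w w' no_path by simp
      qed
    qed
    have S_w: "{s'. s' \<in> S \<and> E w s'} = {s}" "{s'. s' \<in> S \<and> E w' s'} = {s}"
      using only_s w w' by (auto simp: att_def)
    then have "card S \<noteq> 1" using only_s[of s] s(1) by (auto simp: card_1_singleton_iff)
    then have k2: "k \<ge> 2" using k by (simp add: k_def)
    have eqs: "l * x w = x s + x w'" "l * x w' = x s + x w"
      using eig_split[OF B_in_Z[OF w(1)], unfolded nb S_w]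
        eig_split[OF B_in_Z[OF w'(1)], unfolded nb S_w] by simp_all
    then have "(l + 1) * (x w - x w') = 0" by (simp add: algebra_simps)
    then have "x w = x w'" using l by simp
    then have lx: "l * x w = x s + x w" using eqs by simp
    moreover have "x s \<le> sigma"
      unfolding sigma_def using s fin S pos by (intro member_le_sum) (auto intro: less_imp_le)
    \<comment> \<open>As \<open>l \<ge> 2\<close>, half of \<open>l * x w\<close> absorbs
      \<open>x w\<close>; the resulting factor 2 is paid for by \<open>k \<ge> 2\<close>.\<close>
    moreover have "2 * x w \<le> l * x w" using l2 w pos[of w] by (intro mult_right_mono) (auto simp: B_def)
    ultimately have "l * x w \<le> 2 * sigma" by linarith
    also have "\<dots> \<le> real k * sigma * (1 + real (card (leaves w)))"
    proof -
      have "2 * sigma * 1 \<le> real k * sigma * (1 + real (card (leaves w)))"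
        using k2 sigma_pos by (intro mult_mono) auto
      then show ?thesis by simp
    qed
    finally show ?thesis using l S_w by (simp add: field_simps)
  next
    case False
    then have nb: "{u. u \<in> B \<and> E w u} = leaves w" by (auto simp: leaves_def)
    have leaf: "l * x u = x w" if "u \<in> leaves w" for u
    proof -
      have u: "u \<in> B" "E w u" "\<not> att u" using that by (auto simp: leaves_def)
      then have "{v. v \<in> B \<and> E u v} = {w}" using cherry[of w u] w sym by blast
      moreover have "{s. s \<in> S \<and> E u s} = {}" using u by (auto simp: att_def)
      ultimately show ?thesis using eig_split[OF B_in_Z[OF u(1)]] by (simp only: sum.empty) simp
    qed
    define r where "r = real (card (leaves w))"
    have "l * (l * x w) = l * (\<Sum>s | s \<in> S \<and> E w s. x s) + (\<Sum>u\<in>leaves w. l * x u)"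
      using eig_split[OF B_in_Z[OF w(1)], unfolded nb] by (simp add: distrib_left sum_distrib_left)
    also have "(\<Sum>u\<in>leaves w. l * x u) = r * x w" using leaf by (simp add: r_def)
    finally have "(l\<^sup>2 - r) * x w \<le> l * sigma"
      using mult_left_mono[OF S_part_le[of w], of l] l by (simp add: power2_eq_square algebra_simps)
    then have "(1 + r) * ((l\<^sup>2 - r) * x w) \<le> (1 + r) * (l * sigma)"
      by (intro mult_left_mono) (auto simp: r_def)
    \<comment> \<open>Amounts to \<open>r * (l\<^sup>2 - (1 + r)) \<ge> 0\<close>, and
      \<open>1 + r\<close> is at most \<open>card B\<close>, hence at most
      \<open>l\<^sup>2\<close>.\<close>
    moreover have "l\<^sup>2 * x w \<le> (1 + r) * ((l\<^sup>2 - r) * x w)"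
    proof -
      have "insert w (leaves w) \<subseteq> B" using w by (auto simp: leaves_def)
      then have "card (insert w (leaves w)) \<le> card B" by (rule card_mono[OF fin(3)])
      moreover have "w \<notin> leaves w" using irr by (simp add: leaves_def)
      moreover have "finite (leaves w)" using fin by (simp add: leaves_def)
      ultimately have "1 + r \<le> l\<^sup>2" using lB real_card_B by (simp add: r_def)
      then have "0 \<le> r * (l\<^sup>2 - (1 + r))" by (simp add: r_def)
      then have "l\<^sup>2 \<le> (1 + r) * (l\<^sup>2 - r)" by (simp add: algebra_simps)
      from mult_right_mono[OF this, of "x w"] show ?thesis
        using pos[of w] w by (simp add: B_def mult.assoc)
    qed
    ultimately have "l * (l * x w) \<le> l * ((1 + r) * sigma)"
      by (simp add: power2_eq_square algebra_simps)
    then have lx: "l * x w \<le> (1 + r) * sigma" using l by simp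
    have "card {s \<in> S. E w s} \<le> k" unfolding k_def using fin by (intro card_mono) auto
    then have "real (card {s \<in> S. E w s}) * (l * x w) \<le> real k * ((1 + r) * sigma)"
      using mult_mono[OF _ lx, of "real (card {s \<in> S. E w s})" "real k"] l pos[OF B_in_Z[OF w(1)]] by simp
    then show ?thesis using l by (simp add: r_def field_simps)
  qed
  define A where "A = {w \<in> B. att w}"
  have finA: "finite A" using fin by (simp add: A_def)
  have "(\<Sum>v\<in>B. real (card {s \<in> S. E v s}) * x v) = (\<Sum>v\<in>A. real (card {s \<in> S. E v s}) * x v)"
    using fin by (intro sum.mono_neutral_right) (auto simp: A_def att_def)
  also have "\<dots> \<le> (\<Sum>v\<in>A. real k * sigma * (1 + real (card (leaves v))) / l)"
    using weight by (intro sum_mono) (auto simp: A_def)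
  also have "\<dots> = real k * sigma / l * (real (card A) + real (\<Sum>v\<in>A. card (leaves v)))"
    by (simp add: sum.distrib sum_distrib_left add_divide_distrib algebra_simps sum_divide_distrib)
  also have "\<dots> \<le> real k * sigma / l * real (card B)"
  proof -
    \<comment> \<open>By \<open>cherry\<close> a leaf has one centre only, so no vertex is charged
      twice.\<close>
    have "(\<Sum>v\<in>A. card (leaves v)) = card (\<Union>v\<in>A. leaves v)"
    proof (rule card_UN_disjoint[symmetric, OF finA])
      show "\<forall>v\<in>A. finite (leaves v)" using fin by (simp add: leaves_def)
      show "\<forall>v\<in>A. \<forall>w\<in>A. v \<noteq> w \<longrightarrow> leaves v \<inter> leaves w = {}"
        using cherry sym by (fastforce simp: A_def leaves_def)
    qed
    also have "\<dots> \<le> card (B - A)"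
      using fin by (intro card_mono) (auto simp: A_def leaves_def)
    finally have "card A + (\<Sum>v\<in>A. card (leaves v)) \<le> card A + card (B - A)" by simp
    also have "\<dots> = card B"
      using card_Diff_subset[OF finA, of B] card_mono[OF fin(3), of A] by (auto simp: A_def)
    finally have "real (card A) + real (\<Sum>v\<in>A. card (leaves v)) \<le> real (card B)" by linarith
    then show ?thesis using sigma_pos l by (intro mult_left_mono) auto
  qed
  finally have "l * sigma \<le> (real k - 1) * sigma + real k * sigma / l * real (card B)"
    using sigma_bound by linarith
  then have "(l\<^sup>2 - (real k - 1) * l) * sigma \<le> (real k * (real (card Z) - real k)) * sigma"
    using l by (simp add: field_simps power2_eq_square real_card_B)
  then show ?thesis using sigma_pos by simp
qed

end

section \<open>The eigenvalues of the extremal graphs\<close>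

lemma simple_graph_S: "simple_graph {0..<n} (S_graph n k)"
  by (auto simp: simple_graph_def S_graph_def)

lemma simple_graph_S_plus: "simple_graph {0..<n} (S_plus_graph n k)"
  by (auto simp: simple_graph_def S_plus_graph_def S_graph_def)

lemma sum_S_graph_row:
  fixes k n v :: nat
  assumes "k \<le> n"
  shows "(\<Sum>u | u \<in> {0..<n} \<and> u \<noteq> v \<and> (v < k \<or> u < k). y u)
    = (if v < k then (\<Sum>u\<in>{0..<k} - {v}. y u) + (\<Sum>u\<in>{k..<n}. y u) else (\<Sum>u\<in>{0..<k}. y u))"
proof (cases "v < k")
  case True
  then have "{u. u \<in> {0..<n} \<and> u \<noteq> v \<and> (v < k \<or> u < k)} = ({0..<k} - {v}) \<union> {k..<n}"
    using assms by auto
  then show ?thesis using True by (simp add: sum.union_disjoint disjoint_iff)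
next
  case False
  then have "{u. u \<in> {0..<n} \<and> u \<noteq> v \<and> (v < k \<or> u < k)} = {0..<k}" using assms by auto
  then show ?thesis using False by simp
qed

lemma S_graph_eigenvalue:
  assumes "1 \<le> k" "k < n" and mu: "mu \<noteq> 0" "mu\<^sup>2 = (real k - 1) * mu + real k * (real n - real k)"
  shows "adj_eigenvalue {0..<n} (S_graph n k) mu"
  unfolding adj_eigenvalue_alt[OF finite_atLeastLessThan]
proof (intro exI conjI ballI)
  \<comment> \<open>The rows of the independent set hold for every \<open>mu\<close>; a clique row
    is the quadratic equation.\<close>
  define y where "y u = (if u < k then mu else real k)" for u
  show "\<exists>v\<in>{0..<n}. y v \<noteq> 0" using assms by (auto simp: y_def intro!: bexI[of _ 0])
  fix v assume v: "v \<in> {0..<n}"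
  have "(\<Sum>u | u \<in> {0..<n} \<and> S_graph n k v u. y u)
      = (\<Sum>u | u \<in> {0..<n} \<and> u \<noteq> v \<and> (v < k \<or> u < k). y u)"
    using v by (intro sum.cong) (auto simp: S_graph_def)
  also have "\<dots> = mu * y v"
  proof (cases "v < k")
    case True
    then have "(\<Sum>u\<in>{0..<k} - {v}. y u) = (real k - 1) * mu"
      using assms(1) by (simp add: y_def of_nat_diff)
    moreover have "(\<Sum>u\<in>{k..<n}. y u) = real k * (real n - real k)"
      using assms(2) by (simp add: y_def of_nat_diff)
    ultimately show ?thesis
      unfolding sum_S_graph_row[OF less_imp_le[OF assms(2)]]
      using True mu(2) by (simp add: y_def power2_eq_square)
  next
    case False
    then show ?thesis
      unfolding sum_S_graph_row[OF less_imp_le[OF assms(2)]] by (simp add: y_def)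
  qed
  finally show "(\<Sum>u | u \<in> {0..<n} \<and> S_graph n k v u. y u) = mu * y v" .
qed

lemma S_plus_graph_eigenvalue:
  assumes "1 \<le> k" "k + 1 < n" and mu: "mu > 1"
    "(mu\<^sup>2 - (real k - 1) * mu - real k * (real n - real k)) * (mu - 1) = 2 * real k"
  shows "adj_eigenvalue {0..<n} (S_plus_graph n k) mu"
  unfolding adj_eigenvalue_alt[OF finite_atLeastLessThan]
proof (intro exI conjI ballI)
  \<comment> \<open>Constant on the three vertex classes and scaled to clear the denominator
    \<open>mu - 1\<close>; a clique row is the cubic.\<close>
  define y where "y u = (if u < k then mu * (mu - 1) else if u < k + 2 then real k * mu
    else real k * (mu - 1))" for u
  show "\<exists>v\<in>{0..<n}. y v \<noteq> 0" using assms by (auto simp: y_def intro!: bexI[of _ 0])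
  fix v assume v: "v \<in> {0..<n}"
  have hubs: "(\<Sum>u\<in>{0..<k}. y u) = real k * (mu * (mu - 1))" by (simp add: y_def)
  consider "v < k" | "v = k \<or> v = k + 1" | "k + 2 \<le> v" by linarith
  then show "(\<Sum>u | u \<in> {0..<n} \<and> S_plus_graph n k v u. y u) = mu * y v"
  proof cases
    case 1
    have "(\<Sum>u | u \<in> {0..<n} \<and> S_plus_graph n k v u. y u)
        = (\<Sum>u | u \<in> {0..<n} \<and> u \<noteq> v \<and> (v < k \<or> u < k). y u)"
      using v 1 by (intro sum.cong) (auto simp: S_graph_def S_plus_graph_def)
    also have "\<dots> = (\<Sum>u\<in>{0..<k} - {v}. y u) + (\<Sum>u\<in>{k..<n}. y u)"
      using 1 assms(2) by (subst sum_S_graph_row) auto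
    also have "(\<Sum>u\<in>{0..<k} - {v}. y u) = (real k - 1) * (mu * (mu - 1))"
      using 1 assms(1) by (simp add: y_def of_nat_diff)
    also have "(\<Sum>u\<in>{k..<n}. y u) = (\<Sum>u\<in>{k..<k+2}. y u) + (\<Sum>u\<in>{k+2..<n}. y u)"
      using assms(2) by (intro sum.atLeastLessThan_concat[symmetric]) auto
    also have "(\<Sum>u\<in>{k..<k+2}. y u) = 2 * (real k * mu)" by (simp add: y_def)
    also have "(\<Sum>u\<in>{k+2..<n}. y u) = (real n - real k - 2) * (real k * (mu - 1))"
      using assms(2) by (simp add: y_def of_nat_diff)
    finally show ?thesis
      using mu(2) 1 by (simp add: y_def algebra_simps power2_eq_square)
  next
    case 2
    \<comment> \<open>\<open>2 * k + 1 - v\<close> is the other end of the added edge.\<close>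
    have "{u. u \<in> {0..<n} \<and> S_plus_graph n k v u} = insert (2 * k + 1 - v) {0..<k}"
      using v 2 assms(2) by (auto simp: S_graph_def S_plus_graph_def)
    moreover have "y (2 * k + 1 - v) = real k * mu" using 2 by (auto simp: y_def)
    moreover have "2 * k + 1 - v \<notin> {0..<k}" using 2 by auto
    ultimately have "(\<Sum>u | u \<in> {0..<n} \<and> S_plus_graph n k v u. y u)
        = real k * mu + real k * (mu * (mu - 1))"
      by (simp only: sum.insert finite_atLeastLessThan hubs not_False_eq_True)
    moreover have "y v = real k * mu" using 2 by (auto simp: y_def)
    ultimately show ?thesis by (simp add: algebra_simps)
  next
    case 3
    have "{u. u \<in> {0..<n} \<and> S_plus_graph n k v u} = {0..<k}"
      using v 3 assms(2) by (auto simp: S_graph_def S_plus_graph_def)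
    then show ?thesis using 3 hubs by (simp add: y_def)
  qed
qed

text \<open>The closed form \<open>mu\<close> is an eigenvalue, hence at most \<open>l\<close>. The
  inequality passes from \<open>mu\<close> to \<open>l\<close> because \<open>t * (t - b)\<close>
  increases for \<open>t \<ge> b\<close>.\<close>

lemma spectral_radius_S_lower:
  assumes "1 \<le> k" "k < n" and l: "spectral_radius {0..<n} (S_graph n k) \<le> l"
  shows "0 < l" "real k * (real n - real k) \<le> l\<^sup>2 - (real k - 1) * l"
proof -
  define b where "b = real k - 1"
  define c where "c = real k * (real n - real k)"
  define mu where "mu = (b + sqrt (b\<^sup>2 + 4 * c)) / 2"
  have b: "b \<ge> 0" and c: "c > 0" using assms by (auto simp: b_def c_def)
  have "sqrt (b\<^sup>2 + 4 * c) > b" using c b by (intro real_less_rsqrt) auto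
  then have mu: "mu > b" by (simp add: mu_def)
  have "2 * mu - b = sqrt (b\<^sup>2 + 4 * c)" by (simp add: mu_def field_simps)
  then have "(2 * mu - b)\<^sup>2 = b\<^sup>2 + 4 * c" using c by simp
  then have mu2: "mu\<^sup>2 = b * mu + c" by (simp add: power2_eq_square algebra_simps)
  have "mu \<le> l"
    using adj_eigenvalue_le_spectral_radius[OF simple_graph_S S_graph_eigenvalue[OF assms(1,2)]]
      mu b mu2 l by (force simp: b_def c_def)
  moreover from this have "mu * (mu - b) \<le> l * (l - b)" using mu b by (intro mult_mono) auto
  ultimately show "0 < l" "real k * (real n - real k) \<le> l\<^sup>2 - (real k - 1) * l"
    using mu b mu2 by (simp_all add: b_def c_def power2_eq_square algebra_simps)
qed

text \<open>The intermediate value theorem supplies a root \<open>mu > 1\<close> of the cubic in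
  place of a closed form. At \<open>mu\<close> both factors of \<open>p\<close> are positive, and
  neither decreases from there to \<open>l\<close>.\<close>

lemma spectral_radius_S_plus_lower:
  assumes "1 \<le> k" "k + 1 < n" and l: "spectral_radius {0..<n} (S_plus_graph n k) \<le> l"
  shows "1 < l" "2 * real k \<le> (l\<^sup>2 - (real k - 1) * l - real k * (real n - real k)) * (l - 1)"
proof -
  define b where "b = real k - 1"
  define c where "c = real k * (real n - real k)"
  define p where "p t = (t\<^sup>2 - b * t - c) * (t - 1)" for t :: real
  have b: "b \<ge> 0" and c: "c > 0" using assms by (auto simp: b_def c_def)
  \<comment> \<open>Large enough that \<open>t1 * (t1 - b) \<ge> c + 2 * k + 2\<close> and
    \<open>t1 - 1 \<ge> 1\<close>.\<close>
  define t1 where "t1 = b + c + 2 * real k + 2"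
  have "p 1 \<le> 2 * real k" by (simp add: p_def)
  moreover have "2 * real k \<le> p t1"
  proof -
    have "c + 2 * real k + 2 \<le> t1 * (c + 2 * real k + 2)"
      using b c by (intro mult_right_mono[of 1 t1, simplified]) (auto simp: t1_def)
    then have "2 * real k \<le> t1\<^sup>2 - b * t1 - c" by (simp add: t1_def power2_eq_square algebra_simps)
    then have "2 * real k * 1 \<le> (t1\<^sup>2 - b * t1 - c) * (t1 - 1)"
      using b c by (intro mult_mono) (auto simp: t1_def)
    then show ?thesis by (simp add: p_def)
  qed
  moreover have "1 \<le> t1" using b c by (simp add: t1_def)
  ultimately obtain mu where mu: "1 \<le> mu" "p mu = 2 * real k"
    using IVT'[of p 1 "2 * real k" t1] unfolding p_def by (force intro: continuous_intros)
  have "mu \<noteq> 1" using mu assms(1) by (auto simp: p_def)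
  then have mu1: "mu > 1" using mu by simp
  have g: "mu\<^sup>2 - b * mu - c > 0" 
    using zero_less_mult_pos2[of "mu\<^sup>2 - b * mu - c" "mu - 1"] mu(2) mu1 assms(1)
    by (simp add: p_def)
  then have "mu * (mu - b) > 0" using c by (simp add: power2_eq_square algebra_simps)
  then have mub: "mu > b" using mu1 by (simp add: zero_less_mult_iff)
  have "mu \<le> l"
    using adj_eigenvalue_le_spectral_radius[OF simple_graph_S_plus S_plus_graph_eigenvalue[OF assms(1,2) mu1]]
      mu l by (force simp: b_def c_def p_def)
  then have "mu * (mu - b) \<le> l * (l - b)" using mu1 mub by (intro mult_mono) auto
  then have "mu\<^sup>2 - b * mu - c \<le> l\<^sup>2 - b * l - c" by (simp add: power2_eq_square algebra_simps)
  then have "p mu \<le> p l" unfolding p_def using g mu1 \<open>mu \<le> l\<close> by (intro mult_mono) auto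
  then show "1 < l" "2 * real k \<le> (l\<^sup>2 - (real k - 1) * l - real k * (real n - real k)) * (l - 1)"
    using mu mu1 \<open>mu \<le> l\<close> by (simp_all add: p_def b_def c_def)
qed

section \<open>The extremal graphs up to isomorphism\<close>

lemma graph_iso_nth:
  assumes "distinct vs" "\<And>i j. i < length vs \<Longrightarrow> j < length vs \<Longrightarrow> E (vs ! i) (vs ! j) \<longleftrightarrow> F i j"
  shows "graph_iso (set vs) E {0..<length vs} F"
proof -
  define f where "f = the_inv_into {..<length vs} ((!) vs)"
  have nth: "bij_betw ((!) vs) {..<length vs} (set vs)" using assms(1) by (rule bij_betw_nth) auto
  then have f: "bij_betw f (set vs) {..<length vs}" unfolding f_def by (rule bij_betw_the_inv_into)
  have inv: "vs ! f v = v" "f v < length vs" if "v \<in> set vs" for v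
    using f_the_inv_into_f_bij_betw[OF nth that] bij_betwE[OF f] that by (auto simp: f_def)
  show ?thesis
    unfolding graph_iso_def
  proof (intro exI conjI ballI)
    show "bij_betw f (set vs) {0..<length vs}" using f by (simp add: lessThan_atLeast0)
    fix u v assume "u \<in> set vs" "v \<in> set vs"
    then show "E u v = F (f u) (f v)" using assms(2)[of "f u" "f v"] inv by simp
  qed
qed

text \<open>Vertices are numbered by listing \<open>S\<close> first. The order \<open>bs\<close> of
  the rest is left to the caller, who has to place the ends of an extra edge at positions
  \<open>k\<close> and \<open>k + 1\<close>.\<close>

lemma graph_iso_join:
  assumes G: "simple_graph V E" and S: "S \<subseteq> V" "card S = k" and n: "card V = n"
    and compl: "\<forall>s\<in>S. \<forall>v\<in>V. v \<noteq> s \<longrightarrow> E s v"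
    and bs: "set bs = V - S" "distinct bs"
    and F_join: "\<And>i j. i < n \<Longrightarrow> j < n \<Longrightarrow> i < k \<or> j < k \<Longrightarrow> F i j \<longleftrightarrow> i \<noteq> j"
    and F_rest: "\<And>i j. i < length bs \<Longrightarrow> j < length bs \<Longrightarrow> F (k + i) (k + j) \<longleftrightarrow> E (bs ! i) (bs ! j)"
  shows "graph_iso V E {0..<n} F"
proof -
  have V: "finite V" and sym: "\<And>u v. E u v \<Longrightarrow> E v u" and irr: "\<And>v. \<not> E v v"
    using G by (auto simp: simple_graph_def)
  have compl': "E s v" "E v s" if "s \<in> S" "v \<in> V" "v \<noteq> s" for s v
    using compl sym that by blast+
  obtain ss where ss: "set ss = S" "distinct ss"
    using finite_distinct_list finite_subset[OF S(1) V] by metis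
  define vs where "vs = ss @ bs"
  have "set vs = V" using ss bs S by (auto simp: vs_def)
  moreover have "distinct vs" using ss bs by (auto simp: vs_def)
  ultimately have vs: "set vs = V" "distinct vs" "length vs = n" "length ss = k"
    using ss S n distinct_card[of vs] distinct_card[of ss] by simp_all
  have in_V: "vs ! i \<in> V" if "i < n" for i using vs that nth_mem by metis
  have in_S: "vs ! i \<in> S" if "i < k" for i using vs(4) ss(1) that by (auto simp: vs_def nth_append)
  have "E (vs ! i) (vs ! j) \<longleftrightarrow> F i j" if ij: "i < n" "j < n" for i j
  proof (cases "i < k \<or> j < k")
    case True
    have "vs ! i = vs ! j \<longleftrightarrow> i = j" using vs ij by (simp add: nth_eq_iff_index_eq)
    then have "E (vs ! i) (vs ! j) \<longleftrightarrow> i \<noteq> j"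
      using True compl' in_S in_V ij irr by metis
    then show ?thesis using F_join[OF ij True] by simp
  next
    case False
    moreover have "length vs = k + length bs" using vs(4) by (simp add: vs_def)
    ultimately have "i - k < length bs" "j - k < length bs" using ij vs(3) by auto
    from F_rest[OF this] False show ?thesis using vs(4) by (simp add: vs_def nth_append)
  qed
  then show ?thesis using graph_iso_nth[of vs E F] vs by simp
qed

lemma graph_iso_S:
  assumes G: "simple_graph V E" and S: "S \<subseteq> V" "card S = k" and n: "card V = n"
    and compl: "\<forall>s\<in>S. \<forall>v\<in>V. v \<noteq> s \<longrightarrow> E s v"
    and indep: "\<forall>u\<in>V - S. \<forall>v\<in>V - S. \<not> E u v"
  shows "graph_iso V E {0..<n} (S_graph n k)"
proof -
  have "finite (V - S)" using G by (simp add: simple_graph_def)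
  then obtain bs where bs: "set bs = V - S" "distinct bs" using finite_distinct_list by blast
  show ?thesis
  proof (rule graph_iso_join[OF G S n compl bs])
    show "S_graph n k i j \<longleftrightarrow> i \<noteq> j" if "i < n" "j < n" "i < k \<or> j < k" for i j
      using that by (auto simp: S_graph_def)
    show "S_graph n k (k + i) (k + j) \<longleftrightarrow> E (bs ! i) (bs ! j)"
      if "i < length bs" "j < length bs" for i j
      using nth_mem[OF that(1)] nth_mem[OF that(2)] bs(1) indep by (auto simp: S_graph_def)
  qed
qed

lemma graph_iso_S_plus:
  assumes G: "simple_graph V E" and S: "S \<subseteq> V" "card S = k" and n: "card V = n"
    and compl: "\<forall>s\<in>S. \<forall>v\<in>V. v \<noteq> s \<longrightarrow> E s v"
    and w: "w \<in> V - S" "w' \<in> V - S" "E w w'"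
    and only: "\<forall>u\<in>V - S. \<forall>v\<in>V - S. E u v \<longrightarrow> {u, v} = {w, w'}"
  shows "graph_iso V E {0..<n} (S_plus_graph n k)"
proof -
  have V: "finite V" and sym: "\<And>u v. E u v \<Longrightarrow> E v u" and irr: "\<And>v. \<not> E v v"
    using G by (auto simp: simple_graph_def)
  have ww: "w \<noteq> w'" using w irr by auto
  obtain cs where cs: "set cs = V - S - {w, w'}" "distinct cs"
    using finite_distinct_list[of "V - S - {w, w'}"] V by auto
  define bs where "bs = w # w' # cs"
  have bs: "set bs = V - S" "distinct bs" using cs w ww by (auto simp: bs_def)
  have "length bs = n - k"
    using distinct_card[OF bs(2)] bs(1) card_Diff_subset[of S V] finite_subset[OF S(1) V] S n by simp
  then have kn: "k + 1 < n" by (simp add: bs_def)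
  show ?thesis
  proof (rule graph_iso_join[OF G S n compl bs])
    show "S_plus_graph n k i j \<longleftrightarrow> i \<noteq> j" if "i < n" "j < n" "i < k \<or> j < k" for i j
      using that by (auto simp: S_plus_graph_def S_graph_def)
    fix i j assume ij: "i < length bs" "j < length bs"
    have idx: "bs ! m = w \<longleftrightarrow> m = 0" "bs ! m = w' \<longleftrightarrow> m = 1" if "m < length bs" for m
      using nth_eq_iff_index_eq[OF bs(2) that, of 0] nth_eq_iff_index_eq[OF bs(2) that, of 1]
      by (simp_all add: bs_def)
    have "bs ! i \<in> V - S" "bs ! j \<in> V - S" using ij bs(1) nth_mem by blast+
    then have "E (bs ! i) (bs ! j) \<longleftrightarrow> {bs ! i, bs ! j} = {w, w'}"
      using only w(3) sym[OF w(3)] by (auto simp: doubleton_eq_iff)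
    then show "S_plus_graph n k (k + i) (k + j) \<longleftrightarrow> E (bs ! i) (bs ! j)"
      using idx[OF ij(1)] idx[OF ij(2)] kn
      by (auto simp: S_plus_graph_def S_graph_def doubleton_eq_iff)
  qed
qed

section \<open>A component carrying the spectral radius\<close>

text \<open>A Perron vector of a disconnected graph may vanish on some components. From a vertex of
  positive weight positivity spreads along edges, since \<open>l > 0\<close>, and the set reached
  inherits the eigenvalue equation.\<close>

lemma perron_component:
  assumes G: "simple_graph V E" and l: "l = spectral_radius V E" "0 < l" and ne: "V \<noteq> {}"
  obtains Z x where "Z \<subseteq> V" "Z \<noteq> {}" "\<And>v. v \<in> Z \<Longrightarrow> 0 < x v"
    "\<And>u v. u \<in> Z \<Longrightarrow> E u v \<Longrightarrow> v \<in> Z"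
    "\<And>W. W \<subseteq> Z \<Longrightarrow> W \<noteq> {} \<Longrightarrow> \<forall>u\<in>W. \<forall>v. E u v \<longrightarrow> v \<in> W \<Longrightarrow> W = Z"
    "\<And>v. v \<in> Z \<Longrightarrow> (\<Sum>u | u \<in> Z \<and> E v u. x u) = l * x v"
proof -
  have V: "finite V" and sym: "\<And>u v. E u v \<Longrightarrow> E v u" and inV: "\<And>u v. E u v \<Longrightarrow> u \<in> V \<and> v \<in> V"
    using G by (auto simp: simple_graph_def)
  obtain x where x: "\<And>v. 0 \<le> x v" "\<exists>v\<in>V. x v \<noteq> 0"
    "\<And>v. v \<in> V \<Longrightarrow> (\<Sum>u | u \<in> V \<and> E v u. x u) = l * x v"
    by (rule spectral_radius_perron[OF G ne, folded l(1)], rule that)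
  obtain v0 where "v0 \<in> V" "x v0 \<noteq> 0" using x(2) by blast
  then have v0: "v0 \<in> V" "x v0 > 0" using x(1)[of v0] by auto
  define Z where "Z = {v. E\<^sup>*\<^sup>* v0 v}"
  have step: "v \<in> Z" if "u \<in> Z" "E u v" for u v
    using that by (auto simp: Z_def intro: rtranclp.rtrancl_into_rtrancl)
  have pos: "0 < x v \<and> v \<in> V" if "v \<in> Z" for v
  proof -
    have "E\<^sup>*\<^sup>* v0 v" using that by (simp add: Z_def)
    then show ?thesis
    proof (induction rule: rtranclp_induct)
      case base
      then show ?case using v0 by simp
    next
      case (step u v)
      then have v: "v \<in> V" "E v u" using inV sym by blast+
      have "0 < (\<Sum>u | u \<in> V \<and> E v u. x u)"
        using step v V x(1) by (intro sum_pos2[of _ u]) auto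
      then show ?case using x(3)[OF v(1)] l(2) v by (simp add: zero_less_mult_iff)
    qed
  qed
  have conn: "W = Z" if W: "W \<subseteq> Z" "W \<noteq> {}" "\<forall>u\<in>W. \<forall>v. E u v \<longrightarrow> v \<in> W" for W
  proof -
    obtain w where w: "w \<in> W" using W by blast
    have closed: "v \<in> W" if "E\<^sup>*\<^sup>* u v" "u \<in> W" for u v
      using that by (induction rule: rtranclp_induct) (use W(3) in auto)
    have "symp E\<^sup>*\<^sup>*" using sym by (intro symp_rtranclp sympI)
    moreover have "E\<^sup>*\<^sup>* v0 w" using w W by (auto simp: Z_def)
    ultimately have "E\<^sup>*\<^sup>* w v0" by (rule sympD)
    then have "v0 \<in> W" using closed w by blast
    then show ?thesis using closed W(1) by (auto simp: Z_def)
  qed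
  have eig: "(\<Sum>u | u \<in> Z \<and> E v u. x u) = l * x v" if "v \<in> Z" for v
  proof -
    have "{u. u \<in> Z \<and> E v u} = {u. u \<in> V \<and> E v u}" using step[OF that] pos by auto
    then show ?thesis using x(3) pos[OF that] by simp
  qed
  have "v0 \<in> Z" by (simp add: Z_def)
  then show thesis using that[of Z x] pos step conn eig by blast
qed

lemma perron_component_biclique:
  assumes G: "simple_graph V E" and n: "card V = n" "2 ^ (4 * k) \<le> n" and k: "k \<ge> 1"
    and l: "l = spectral_radius V E" "0 < l"
    and low: "real k * (real n - real k) \<le> l\<^sup>2 - (real k - 1) * l"
    and no_path: "\<not> has_path V E (2 * k + 3)"
  obtains Z S T x where "spanning_biclique Z E S T x l" "Z \<subseteq> V" "card S = k"
proof -
  have V: "finite V" and sym: "\<And>u v. E u v \<Longrightarrow> E v u" and irr: "\<And>v. \<not> E v v"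
    using G by (auto simp: simple_graph_def)
  have "n > 0" using n(2) by (metis gr0I le_zero_eq power_not_zero zero_neq_numeral)
  then have ne: "V \<noteq> {}" using n by auto
  obtain Z x where Z: "Z \<subseteq> V" "Z \<noteq> {}" "\<And>v. v \<in> Z \<Longrightarrow> 0 < x v"
    "\<And>u v. u \<in> Z \<Longrightarrow> E u v \<Longrightarrow> v \<in> Z"
    "\<And>W. W \<subseteq> Z \<Longrightarrow> W \<noteq> {} \<Longrightarrow> \<forall>u\<in>W. \<forall>v. E u v \<longrightarrow> v \<in> W \<Longrightarrow> W = Z"
    "\<And>v. v \<in> Z \<Longrightarrow> (\<Sum>u | u \<in> Z \<and> E v u. x u) = l * x v"
    by (rule perron_component[OF G l ne], rule that)
  have finZ: "finite Z" using Z(1) V finite_subset by blast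
  have card_Z: "card Z \<le> n" using card_mono[OF V Z(1)] n by simp
  have no_path_Z: "\<not> has_path Z E (2 * k + 3)" using no_path Z(1) by (auto simp: has_path_def)
  have "has_biclique Z E k (k + 3)"
    by (rule large_eigenvalue_has_biclique[OF finZ sym irr k no_path_Z Z(3,2,6) n(2) card_Z l(2) low])
  then obtain S T where ST: "S \<subseteq> Z" "T \<subseteq> Z" "S \<inter> T = {}" "card S = k" "k + 3 \<le> card T"
    "\<And>u v. u \<in> S \<Longrightarrow> v \<in> T \<Longrightarrow> E u v" by (auto simp: has_biclique_def)
  have S: "S \<noteq> {}" "card S + 3 \<le> card T" using ST(4,5) k by auto
  have "spanning_biclique Z E S T x l"
    by (rule spanning_biclique.intro;
        (fact | erule sym | rule irr | erule (1) Z(4) | rule Z(5); blast | erule (1) ST(6)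
          | erule Z(3) | erule Z(6)))
  then show thesis using that Z(1) ST(4) by blast
qed

lemma extremal_no_even_path:
  assumes G: "simple_graph V E" and n: "card V = n" "2 ^ (4 * k) \<le> n" and k: "k \<ge> 1"
    and sr: "spectral_radius {0..<n} (S_graph n k) \<le> spectral_radius V E"
    and no_path: "\<not> has_path V E (2 * k + 2)"
  shows "graph_iso V E {0..<n} (S_graph n k)"
proof -
  define l where "l = spectral_radius V E"
  have V: "finite V" using G by (simp add: simple_graph_def)
  have "4 * k < 2 ^ (4 * k)" by (rule less_exp)
  then have kn: "k < n" using n by linarith
  have low: "0 < l" "real k * (real n - real k) \<le> l\<^sup>2 - (real k - 1) * l"
    using spectral_radius_S_lower[OF k kn sr] by (simp_all add: l_def)
  have no_path': "\<not> has_path V E (2 * k + 3)"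
    using no_path has_path_shorter[of V E "2 * k + 3" "2 * k + 2"] by auto
  obtain Z S T x where loc: "spanning_biclique Z E S T x l" and Z: "Z \<subseteq> V" and S: "card S = k"
    by (rule perron_component_biclique[OF G n k l_def low no_path'], rule that)
  interpret H: spanning_biclique Z E S T x l by (rule loc)
  have k_eq: "H.k = k" using S H.k_def by simp
  have no_path_Z: "\<not> has_path Z E (2 * k + 2)" using no_path Z by (auto simp: has_path_def)
  have indep: "\<forall>u\<in>H.B. \<forall>v\<in>H.B. \<not> E u v"
    using H.independent_complement[unfolded k_eq, OF no_path_Z] by blast
  note bound = H.eigenvalue_bound_independent[OF indep, unfolded k_eq]
  have "real k * real n \<le> real k * real (card Z)"
    using low(2) bound(1) by (simp add: algebra_simps)
  then have "card Z = card V" using k n card_mono[OF V Z] by simp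
  then have ZV: "Z = V" using card_subset_eq[OF V Z] by simp
  then have "l\<^sup>2 - (real k - 1) * l = real k * (real (card Z) - real k)"
    using low(2) bound(1) n by simp
  from bound(2)[OF this] have compl: "\<forall>s\<in>S. \<forall>v\<in>V. v \<noteq> s \<longrightarrow> E s v" using ZV by blast
  have B: "H.B = V - S" unfolding ZV[symmetric] by (rule H.B_def)
  show ?thesis
    using H.S(1) ZV by (intro graph_iso_S[OF G _ S n(1) compl indep[unfolded B]]) simp
qed


lemma extremal_no_odd_path:
  assumes G: "simple_graph V E" and n: "card V = n" "2 ^ (4 * k) \<le> n" and k: "k \<ge> 1"
    and sr: "spectral_radius {0..<n} (S_plus_graph n k) \<le> spectral_radius V E"
    and no_path: "\<not> has_path V E (2 * k + 3)"
  shows "graph_iso V E {0..<n} (S_plus_graph n k)"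
proof -
  define l where "l = spectral_radius V E"
  have V: "finite V" using G by (simp add: simple_graph_def)
  have "4 * k < 2 ^ (4 * k)" by (rule less_exp)
  then have kn: "4 * k < n" using n by linarith
  then have kn': "k + 1 < n" using k by linarith
  have l1: "1 < l"
    and gap: "2 * real k \<le> (l\<^sup>2 - (real k - 1) * l - real k * (real n - real k)) * (l - 1)"
    using spectral_radius_S_plus_lower[OF k kn' sr] by (simp_all add: l_def)
  have "0 < (l\<^sup>2 - (real k - 1) * l - real k * (real n - real k)) * (l - 1)"
    using gap k by linarith
  then have pos: "0 < l\<^sup>2 - (real k - 1) * l - real k * (real n - real k)"
    by (rule zero_less_mult_pos2) (use l1 in simp)
  have low: "0 < l" "real k * (real n - real k) \<le> l\<^sup>2 - (real k - 1) * l"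
    using pos l1 by simp_all
  \<comment> \<open>Needed to compare stars with isolated vertices in
    \<open>eigenvalue_bound_many_edges\<close>.\<close>
  have nk: "real n - real k \<le> l\<^sup>2"
  proof -
    have "1 * (real n - real k) \<le> real k * (real n - real k)"
      using k kn by (intro mult_right_mono) auto
    also note low(2)
    also have "l\<^sup>2 - (real k - 1) * l \<le> l\<^sup>2" using k low(1) by simp
    finally show ?thesis by simp
  qed
  obtain Z S T x where loc: "spanning_biclique Z E S T x l" and Z: "Z \<subseteq> V" and S: "card S = k"
    by (rule perron_component_biclique[OF G n k l_def low no_path], rule that)
  interpret H: spanning_biclique Z E S T x l by (rule loc)
  have k_eq: "H.k = k" using S H.k_def by simp
  have no_path_Z: "\<not> has_path Z E (2 * k + 3)" using no_path Z by (auto simp: has_path_def)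
  have card_Z: "card Z \<le> n" using card_mono[OF V Z] n by simp
  have "\<exists>w\<in>H.B. \<exists>w'\<in>H.B. E w w' \<and> (\<forall>u\<in>H.B. \<forall>v\<in>H.B. E u v \<longrightarrow> {u, v} = {w, w'})"
  proof (rule ccontr)
    assume "\<not> ?thesis"
    \<comment> \<open>This includes the case of no edge at all outside \<open>S\<close>.\<close>
    then have many: "\<forall>w\<in>H.B. \<forall>w'\<in>H.B. E w w' \<longrightarrow>
        (\<exists>u\<in>H.B. \<exists>v\<in>H.B. E u v \<and> {u, v} \<noteq> {w, w'})" by blast
    have "2 ^ 2 \<le> l\<^sup>2" using nk kn k by simp
    then have l2: "2 \<le> l" by (rule power2_le_imp_le) (use l1 in simp)
    have "real (card Z) - real k \<le> l\<^sup>2" using nk card_Z by linarith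
    from H.eigenvalue_bound_many_edges[unfolded k_eq, OF no_path_Z many l2 this]
    have "l\<^sup>2 - (real k - 1) * l \<le> real k * (real (card Z) - real k)" .
    also have "\<dots> \<le> real k * (real n - real k)" using card_Z by (intro mult_left_mono) auto
    finally show False using pos by simp
  qed
  then obtain w w' where w: "w \<in> H.B" "w' \<in> H.B" "E w w'"
    and only: "\<forall>u\<in>H.B. \<forall>v\<in>H.B. E u v \<longrightarrow> {u, v} = {w, w'}" by blast
  have ww: "w \<noteq> w'" using w(3) H.irr by auto
  note bound = H.eigenvalue_bound_one_edge[OF w(1,2) ww l1 only, unfolded k_eq]
  have "real k * (l - 1) * (real n - real (card Z)) \<le> 0"
    using gap bound(1) by (simp add: algebra_simps)
  then have "real n \<le> real (card Z)" using k l1 by (simp add: mult_le_0_iff)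
  then have "card Z = card V" using card_Z n by simp
  then have ZV: "Z = V" using card_subset_eq[OF V Z] by simp
  then have "(l\<^sup>2 - (real k - 1) * l - real k * (real (card Z) - real k)) * (l - 1) = 2 * real k"
    using gap bound(1) n by simp
  from bound(2)[OF this] have compl: "\<forall>s\<in>S. \<forall>v\<in>V. v \<noteq> s \<longrightarrow> E s v" using ZV by blast
  have B: "H.B = V - S" unfolding ZV[symmetric] by (rule H.B_def)
  show ?thesis
    using H.S(1) ZV
    by (intro graph_iso_S_plus[OF G _ S n(1) compl w[unfolded B] only[unfolded B]]) simp
qed

theorem theorem1:
  fixes V :: "'a set" and E :: "'a \<Rightarrow> 'a \<Rightarrow> bool" and n k :: nat
  assumes "k \<ge> 1" and "n \<ge> 2 ^ (4 * k)"
    and "simple_graph V E" and "card V = n"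
  shows "(spectral_radius V E \<ge> spectral_radius {0..<n} (S_graph n k)
            \<longrightarrow> has_path V E (2 * k + 2) \<or> graph_iso V E {0..<n} (S_graph n k))
       \<and> (spectral_radius V E \<ge> spectral_radius {0..<n} (S_plus_graph n k)
            \<longrightarrow> has_path V E (2 * k + 3) \<or> graph_iso V E {0..<n} (S_plus_graph n k))"
  using extremal_no_even_path[OF assms(3,4,2,1)] extremal_no_odd_path[OF assms(3,4,2,1)] by blast

end
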